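(* Let $0<\alpha<2$, let $T$ be an arbitrary index set, and let $(S_i,\mu_i)$, $i=1,2$, be measure spaces with positive $\sigma$-finite measures. Suppose an $\alpha$-Fréchet process $\{X_t\}_{t\in T}$ and an S$\alpha$S process $\{Y_t\}_{t\in T}$ are associated by two spectral representations $\{f_t^{(i)}\}_{t\in T}\subset L^\alpha_+(S_i,\mu_i)$, $i=1,2$; that is, $$\{X_t\}_{t\in T}\stackrel{d}{=}\Big\{{}^{e}\!\!\int_{S_i}f_t^{(i)}\,dM_{\alpha,\vee}^{(i)}\Big\}_{t\in T}\quad\text{and}\quad\{Y_t\}_{t\in T}\stackrel{d}{=}\Big\{\int_{S_i}f_t^{(i)}\,dM_{\alpha,+}^{(i)}\Big\}_{t\in T},\qquad i=1,2,$$ where $M_{\alpha,\vee}^{(i)}$ and $M_{\alpha,+}^{(i)}$ are, respectively, an $\alpha$-Fréchet random sup-measure and an S$\alpha$S random measure on $S_i$ with control measure $\mu_i$. Then, for any measurable subsets $A_i\subset S_i$, $i=1,2$, $$\Big\{{}^{e}\!\!\int_{A_1}f_t^{(1)}\,dM_{\alpha,\vee}^{(1)}\Big\}_{t\in T}\stackrel{d}{=}\Big\{{}^{e}\!\!\int_{A_2}f_t^{(2)}\,dM_{\alpha,\vee}^{(2)}\Big\}_{t\in T}\iff\Big\{\int_{A_1}f_t^{(1)}\,dM_{\alpha,+}^{(1)}\Big\}_{t\in T}\stackrel{d}{=}\Big\{\int_{A_2}f_t^{(2)}\,dM_{\alpha,+}^{(2)}\Big\}_{t\in T}.$$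
   Context: $L^\alpha_+(S,\mu)$ is the set of nonnegative functions in $L^\alpha(S,\mu)$; $\stackrel{d}{=}$ between processes means equality of finite-dimensional distributions. For $\{f_t\}_{t\in T}\subset L^\alpha(S,\mu)$, the process of stable integrals $\{\int_S f_t\,dM_{\alpha,+}\}_{t\in T}$, with $M_{\alpha,+}$ an S$\alpha$S random measure with control measure $\mu$, is the S$\alpha$S (symmetric $\alpha$-stable) process $\{Z_t\}$ whose finite-dimensional distributions are determined by $$\mathbb E\exp\Big\{-i\sum_{j=1}^n a_jZ_{t_j}\Big\}=\exp\Big\{-\int_S\Big|\sum_{j=1}^n a_jf_{t_j}\Big|^\alpha d\mu\Big\},\quad a_j\in\mathbb R,\ t_j\in T,\ n\in\mathbb N.$$ For $\{f_t\}_{t\in T}\subset L^\alpha_+(S,\mu)$, the process of extremal integrals $\{{}^{e}\!\!\int_S f_t\,dM_{\alpha,\vee}\}_{t\in T}$, with $M_{\alpha,\vee}$ an $\alpha$-Fréchet random sup-measure with control measure $\mu$, is the $\alpha$-Fréchet process $\{W_t\}$ whose finite-dimensional distributions are $$\mathbb P(W_{t_1}\le a_1,\dots,W_{t_n}\le a_n)=\exp\Big\{-\int_S\Big(\bigvee_{j=1}^n f_{t_j}/a_j\Big)^\alpha d\mu\Big\},\quad a_j>0,\ t_j\in T,\ n\in\mathbb N.$$ Integrals over a measurable set $A\subset S$ are integrals of $f_t\mathbf 1_A$. *)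

theory Defs
  imports "HOL-Probability.Probability"
begin

text \<open>
  A real-valued process indexed by a set \<open>T\<close> is a pair of a measure \<open>P\<close> and a family \<open>X\<close> of random
  variables on \<open>P\<close>; different processes may live on different probability spaces.
\<close>

definition process :: "'w measure \<Rightarrow> 't set \<Rightarrow> ('t \<Rightarrow> 'w \<Rightarrow> real) \<Rightarrow> bool" where
  "process P T X \<longleftrightarrow> prob_space P \<and> (\<forall>t\<in>T. X t \<in> borel_measurable P)"

definition eq_fdd ::
  "'t set \<Rightarrow> 'w measure \<Rightarrow> ('t \<Rightarrow> 'w \<Rightarrow> real) \<Rightarrow> 'v measure \<Rightarrow> ('t \<Rightarrow> 'v \<Rightarrow> real) \<Rightarrow> bool" where
  "eq_fdd T P X Q Y \<longleftrightarrow>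
     (\<forall>J. finite J \<and> J \<subseteq> T \<longrightarrow>
        distr P (\<Pi>\<^sub>M t\<in>J. borel) (\<lambda>w. \<lambda>t\<in>J. X t w) =
        distr Q (\<Pi>\<^sub>M t\<in>J. borel) (\<lambda>w. \<lambda>t\<in>J. Y t w))"

definition L_space :: "real \<Rightarrow> 'a measure \<Rightarrow> ('a \<Rightarrow> real) set" where
  "L_space \<alpha> M = {f \<in> borel_measurable M. integrable M (\<lambda>x. \<bar>f x\<bar> powr \<alpha>)}"

text \<open>
  Elements of an \<open>L\<close>-space are identified up to null sets, so nonnegativity is required almost
  everywhere only.
\<close>

definition L_space_nonneg :: "real \<Rightarrow> 'a measure \<Rightarrow> ('a \<Rightarrow> real) set" where
  "L_space_nonneg \<alpha> M = {f \<in> L_space \<alpha> M. AE x in M. 0 \<le> f x}"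

text \<open>
  The scale \<open>\<sigma> = 0\<close> is admitted below and describes a variable that vanishes almost surely: it occurs
  as soon as a spectral function vanishes almost everywhere on the domain of integration. In the
  Frechet case the distribution function on \<open>(0, \<infinity>)\<close> does not by itself exclude negative values when
  \<open>\<sigma> = 0\<close>, hence the explicit nonnegativity.
\<close>

definition frechet_rv :: "real \<Rightarrow> 'w measure \<Rightarrow> ('w \<Rightarrow> real) \<Rightarrow> bool" where
  "frechet_rv \<alpha> P \<xi> \<longleftrightarrow>
     (AE w in P. 0 \<le> \<xi> w) \<and>
     (\<exists>\<sigma>\<ge>0. \<forall>x>0. measure P {w \<in> space P. \<xi> w \<le> x} = exp (- ((\<sigma> / x) powr \<alpha>)))"

definition frechet_process :: "real \<Rightarrow> 'w measure \<Rightarrow> 't set \<Rightarrow> ('t \<Rightarrow> 'w \<Rightarrow> real) \<Rightarrow> bool" where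
  "frechet_process \<alpha> P T X \<longleftrightarrow>
     process P T X \<and>
     (\<forall>n\<ge>1. \<forall>(t :: nat \<Rightarrow> 't) (a :: nat \<Rightarrow> real). (\<forall>j<n. t j \<in> T \<and> 0 < a j) \<longrightarrow>
        frechet_rv \<alpha> P (\<lambda>w. MAX j\<in>{..<n}. a j * X (t j) w))"

definition sas_rv :: "real \<Rightarrow> 'w measure \<Rightarrow> ('w \<Rightarrow> real) \<Rightarrow> bool" where
  "sas_rv \<alpha> P \<xi> \<longleftrightarrow>
     (\<exists>\<sigma>\<ge>0. \<forall>\<theta>. char (distr P borel \<xi>) \<theta> = complex_of_real (exp (- ((\<sigma> * \<bar>\<theta>\<bar>) powr \<alpha>))))"

definition sas_process :: "real \<Rightarrow> 'w measure \<Rightarrow> 't set \<Rightarrow> ('t \<Rightarrow> 'w \<Rightarrow> real) \<Rightarrow> bool" where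
  "sas_process \<alpha> P T X \<longleftrightarrow>
     process P T X \<and>
     (\<forall>n\<ge>1. \<forall>(t :: nat \<Rightarrow> 't) (a :: nat \<Rightarrow> real). (\<forall>j<n. t j \<in> T) \<longrightarrow>
        sas_rv \<alpha> P (\<lambda>w. \<Sum>j<n. a j * X (t j) w))"

text \<open>
  The processes of stable and of extremal integrals of a family \<open>f\<close> with respect to a random
  (sup-)measure with control measure \<open>M\<close> are specified through their finite-dimensional
  distributions. The predicates say that \<open>(P, Z)\<close>, respectively \<open>(P, W)\<close>, is a realization.
\<close>

definition stable_integrals ::
  "real \<Rightarrow> 'a measure \<Rightarrow> 't set \<Rightarrow> ('t \<Rightarrow> 'a \<Rightarrow> real) \<Rightarrow> 'w measure \<Rightarrow> ('t \<Rightarrow> 'w \<Rightarrow> real) \<Rightarrow> bool" where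
  "stable_integrals \<alpha> M T f P Z \<longleftrightarrow>
     sas_process \<alpha> P T Z \<and>
     (\<forall>n\<ge>1. \<forall>(t :: nat \<Rightarrow> 't) (a :: nat \<Rightarrow> real). (\<forall>j<n. t j \<in> T) \<longrightarrow>
        (LINT w|P. exp (- (\<i> * complex_of_real (\<Sum>j<n. a j * Z (t j) w)))) =
        complex_of_real (exp (- (LINT x|M. \<bar>\<Sum>j<n. a j * f (t j) x\<bar> powr \<alpha>))))"

definition extremal_integrals ::
  "real \<Rightarrow> 'a measure \<Rightarrow> 't set \<Rightarrow> ('t \<Rightarrow> 'a \<Rightarrow> real) \<Rightarrow> 'w measure \<Rightarrow> ('t \<Rightarrow> 'w \<Rightarrow> real) \<Rightarrow> bool" where
  "extremal_integrals \<alpha> M T f P W \<longleftrightarrow>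
     frechet_process \<alpha> P T W \<and>
     (\<forall>n\<ge>1. \<forall>(t :: nat \<Rightarrow> 't) (a :: nat \<Rightarrow> real). (\<forall>j<n. t j \<in> T \<and> 0 < a j) \<longrightarrow>
        measure P {w \<in> space P. \<forall>j<n. W (t j) w \<le> a j} =
        exp (- (LINT x|M. (MAX j\<in>{..<n}. f (t j) x / a j) powr \<alpha>)))"

definition restrict_family :: "'a set \<Rightarrow> ('t \<Rightarrow> 'a \<Rightarrow> real) \<Rightarrow> 't \<Rightarrow> 'a \<Rightarrow> real" where
  "restrict_family A f = (\<lambda>t x. f t x * indicator A x)"

end

theory Submission
  imports Defs
begin

text \<open>
  For finitely many spectral functions \<open>g j\<close> on a measure space \<open>M\<close>, the law of the stable integrals
  is governed by the exponents \<open>\<integral> \<bar>\<Sum>j. b j * g j\<bar>\<^sup>\<alpha> dM\<close>, the law of the extremal integrals by the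
  exponents \<open>\<integral> (max\<^sub>j (g j / a j))\<^sup>\<alpha> dM\<close>. The theorem reduces to the statement that for
  nonnegative families, on two possibly different spaces, equality of all exponents of the first kind is equivalent
  to equality of all exponents of the second kind. It is applied to the families restricted to
  \<open>A1\<close> and \<open>A2\<close>.

  The link between the exponents is a measure \<open>N\<close> on pairs \<open>(s, r)\<close>, the product of \<open>M\<close> with
  the density \<open>\<bar>r\<bar> powr (- 1 - \<alpha>)\<close>, together with the coordinates \<open>y j = r * g j s\<close>. By homogeneity,
  the integral of \<open>1 - cos (\<Sum>j. b j * y j)\<close> against \<open>N\<close> is a positive constant times the first
  exponent (\<open>levy_measure_one_minus_cos\<close>), and the mass of the set where some \<open>\<bar>y j\<bar>\<close> exceeds \<open>a j\<close>
  is a positive constant times the second (\<open>levy_measure_exceedance\<close>). Here \<open>0 < \<alpha> < 2\<close> makes the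
  constants finite.

  The integrals of \<open>1 - cos\<close> determine the exceedance masses (\<open>exceedances_eqI_cosines\<close>): their
  second differences are the cosine transforms of \<open>N\<close> weighted with a function that vanishes only
  where all \<open>y j\<close> do, the sine transforms vanish by symmetry in \<open>r\<close>, and a finite measure is
  determined by its characteristic function. Conversely, the exceedance masses determine the joint
  law of the \<open>\<bar>y j\<bar>\<close> away from the origin, hence the integrals of \<open>1 - cos\<close>
  (\<open>cosines_eqI_exceedances\<close>), because for \<open>g j \<ge> 0\<close> all coordinates share the sign of \<open>r\<close>
  and \<open>cos\<close> is even.

  Both the passage from exponents to finite-dimensional distributions and these two steps use
  uniqueness theorems for joint laws, from characteristic functions and from distribution
  functions at positive levels. They share one proof: a class of nonnegative functions that
  determines finite measures on the line determines joint laws through products of its members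
  (\<open>determining_joint_distribution\<close>).
\<close>

section \<open>Joint laws from measure-determining classes\<close>

text \<open>
  A class of test functions on the line that separates finite Borel measures. Nonnegative bounded
  test functions are used, rather than complex exponentials, because such a function can be absorbed
  as a density into a finite measure and leaves a finite measure behind.
\<close>

definition measure_determining :: "(real \<Rightarrow> ennreal) set \<Rightarrow> bool" where
  "measure_determining \<Phi> \<longleftrightarrow>
     (\<forall>\<phi>\<in>\<Phi>. \<phi> \<in> borel_measurable borel \<and> (\<exists>c<\<infinity>. \<forall>x. \<phi> x \<le> c)) \<and>
     (\<forall>m1 m2. finite_borel_measure m1 \<and> finite_borel_measure m2 \<and>
        (\<forall>\<phi>\<in>\<Phi>. (\<integral>\<^sup>+x. \<phi> x \<partial>m1) = (\<integral>\<^sup>+x. \<phi> x \<partial>m2)) \<longrightarrow> m1 = m2)"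

lemma finite_measure_density_bounded:
  assumes "finite_measure P" "u \<in> borel_measurable P" "c < \<infinity>" "\<And>w. u w \<le> (c :: ennreal)"
  shows "finite_measure (density P u)"
proof -
  interpret finite_measure P by fact
  have "emeasure (density P u) (space P) = (\<integral>\<^sup>+w. u w \<partial>P)"
    using assms(2) by (simp add: emeasure_density cong: nn_integral_cong)
  also have "\<dots> \<le> (\<integral>\<^sup>+w. c \<partial>P)"
    by (intro nn_integral_mono assms)
  also have "\<dots> < \<infinity>"
    using assms(3) by (simp add: ennreal_mult_less_top less_top[symmetric] ennreal_mult_eq_top_iff)
  finally show ?thesis
    by (intro finite_measureI) simp
qed

text \<open>
  The weights \<open>u\<close> and \<open>v\<close> become densities, and the two weighted laws on the line agree on the
  class. This is what permits replacing one test function at a time by an arbitrary one.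
\<close>

lemma determining_univariate:
  assumes "measure_determining \<Phi>" "finite_measure P" "finite_measure Q"
    and [measurable]: "u \<in> borel_measurable P" "v \<in> borel_measurable Q"
      "\<xi> \<in> borel_measurable P" "\<eta> \<in> borel_measurable Q"
    and bound: "c < \<infinity>" "\<And>w. u w \<le> c" "\<And>w. v w \<le> c"
    and eq: "\<And>\<phi>. \<phi> \<in> \<Phi> \<Longrightarrow> (\<integral>\<^sup>+w. u w * \<phi> (\<xi> w) \<partial>P) = (\<integral>\<^sup>+w. v w * \<phi> (\<eta> w) \<partial>Q)"
    and [measurable]: "h \<in> borel_measurable borel"
  shows "(\<integral>\<^sup>+w. u w * h (\<xi> w) \<partial>P) = (\<integral>\<^sup>+w. v w * h (\<eta> w) \<partial>Q)"
proof -
  have conv: "(\<integral>\<^sup>+x. k x \<partial>distr (density R q) borel \<zeta>) = (\<integral>\<^sup>+w. q w * k (\<zeta> w) \<partial>R)"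
    if [measurable]: "q \<in> borel_measurable R" "\<zeta> \<in> borel_measurable R" "k \<in> borel_measurable borel"
    for R :: "'c measure" and q \<zeta> and k :: "real \<Rightarrow> ennreal"
    by (simp add: nn_integral_distr nn_integral_density)
  have fin: "finite_borel_measure (distr (density R q) borel \<zeta>)"
    if "finite_measure R" and [measurable]: "q \<in> borel_measurable R" "\<zeta> \<in> borel_measurable R"
      and "\<And>w. q w \<le> c" for R :: "'c measure" and q \<zeta>
  proof -
    interpret finite_measure "density R q"
      by (rule finite_measure_density_bounded[OF that(1,2) bound(1) that(4)])
    interpret D: finite_measure "distr (density R q) borel \<zeta>"
      by (rule finite_measure_distr) simp
    show ?thesis by standard simp
  qed
  have \<Phi>m: "\<phi> \<in> borel_measurable borel" if "\<phi> \<in> \<Phi>" for \<phi>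
    using assms(1) that unfolding measure_determining_def by auto
  have "\<forall>\<phi>\<in>\<Phi>. (\<integral>\<^sup>+x. \<phi> x \<partial>distr (density P u) borel \<xi>) = (\<integral>\<^sup>+x. \<phi> x \<partial>distr (density Q v) borel \<eta>)"
    using eq by (simp add: conv \<Phi>m)
  moreover have "finite_borel_measure (distr (density P u) borel \<xi>)"
      "finite_borel_measure (distr (density Q v) borel \<eta>)"
    by (intro fin assms(2,3) bound; measurable)+
  ultimately have "distr (density P u) borel \<xi> = distr (density Q v) borel \<eta>"
    using assms(1) unfolding measure_determining_def by blast
  then show ?thesis
    using conv[of u P \<xi> h] conv[of v Q \<eta> h] by simp
qed

text \<open>
  Induction on \<open>J\<close>, generalizing over both measures. With the test functions in the coordinates of
  \<open>J\<close> held fixed as weights, the univariate lemma turns the test function in the new coordinate \<open>k\<close>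
  into the indicator of \<open>B k\<close>. That indicator then becomes a density, and the induction hypothesis
  applies to the restricted measures.
\<close>

lemma determining_rectangles:
  fixes P :: "'w measure" and Q :: "'v measure"
  assumes \<Phi>: "measure_determining \<Phi>"
    and "finite J" "finite_measure P" "finite_measure Q"
    and "\<And>j. j \<in> J \<Longrightarrow> X j \<in> borel_measurable P" "\<And>j. j \<in> J \<Longrightarrow> Y j \<in> borel_measurable Q"
    and "\<And>\<phi>. \<phi> \<in> J \<rightarrow> \<Phi> \<Longrightarrow> (\<integral>\<^sup>+w. (\<Prod>j\<in>J. \<phi> j (X j w)) \<partial>P) = (\<integral>\<^sup>+w. (\<Prod>j\<in>J. \<phi> j (Y j w)) \<partial>Q)"
    and "\<And>j. j \<in> J \<Longrightarrow> B j \<in> sets borel"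
  shows "(\<integral>\<^sup>+w. (\<Prod>j\<in>J. indicator (B j) (X j w)) \<partial>P) = (\<integral>\<^sup>+w. (\<Prod>j\<in>J. indicator (B j) (Y j w)) \<partial>Q)"
  using assms(2-)
proof (induction J arbitrary: P Q rule: finite_induct)
  case empty
  then show ?case by auto
next
  case (insert k J)
  have [measurable]: "X j \<in> borel_measurable P" "Y j \<in> borel_measurable Q" if "j \<in> insert k J" for j
    using insert.prems that by auto
  have [measurable]: "X k \<in> borel_measurable P" "Y k \<in> borel_measurable Q"
    using insert.prems by auto
  have [measurable]: "B k \<in> sets borel"
    using insert.prems by auto
  have \<Phi>m: "\<phi> \<in> borel_measurable borel" if "\<phi> \<in> \<Phi>" for \<phi>
    using \<Phi> that unfolding measure_determining_def by auto
  let ?P = "density P (\<lambda>w. indicator (B k) (X k w))"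
  let ?Q = "density Q (\<lambda>w. indicator (B k) (Y k w))"
  have swap: "(\<integral>\<^sup>+w. (\<Prod>j\<in>J. \<phi> j (X j w)) * indicator (B k) (X k w) \<partial>P) =
      (\<integral>\<^sup>+w. (\<Prod>j\<in>J. \<phi> j (Y j w)) * indicator (B k) (Y k w) \<partial>Q)" if \<phi>: "\<phi> \<in> J \<rightarrow> \<Phi>" for \<phi>
  proof -
    have "\<forall>j\<in>J. \<exists>c<\<infinity>. \<forall>x. \<phi> j x \<le> c"
      using \<Phi> \<phi> unfolding measure_determining_def by auto
    then obtain c where c: "c j < \<infinity>" "\<phi> j x \<le> c j" if "j \<in> J" for j x
      by metis
    have [measurable]: "\<phi> j \<in> borel_measurable borel" if "j \<in> J" for j
      using \<phi> that by (intro \<Phi>m) auto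
    have "(\<Prod>j\<in>J. c j) < \<infinity>"
      using c(1) by (simp add: less_top[symmetric] ennreal_prod_eq_top)
    show ?thesis
    proof (rule determining_univariate[OF \<Phi> insert.prems(1,2), where c="\<Prod>j\<in>J. c j"])
      show "(\<Prod>j\<in>J. c j) < \<infinity>" by fact
    next
      fix \<psi> assume \<psi>: "\<psi> \<in> \<Phi>"
      have eq: "(\<Prod>j\<in>insert k J. (\<phi>(k := \<psi>)) j (x j)) = (\<Prod>j\<in>J. \<phi> j (x j)) * \<psi> (x k)" for x
      proof -
        have "(\<Prod>j\<in>J. (\<phi>(k := \<psi>)) j (x j)) = (\<Prod>j\<in>J. \<phi> j (x j))"
          using insert.hyps by (intro prod.cong) auto
        then show ?thesis
          using insert.hyps by (simp add: mult.commute)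
      qed
      have "\<phi>(k := \<psi>) \<in> insert k J \<rightarrow> \<Phi>"
        using \<phi> \<psi> by auto
      from insert.prems(5)[OF this]
      show "(\<integral>\<^sup>+w. (\<Prod>j\<in>J. \<phi> j (X j w)) * \<psi> (X k w) \<partial>P) = (\<integral>\<^sup>+w. (\<Prod>j\<in>J. \<phi> j (Y j w)) * \<psi> (Y k w) \<partial>Q)"
        unfolding eq .
    qed (use c in \<open>auto intro!: prod_mono_ennreal\<close>)
  qed
  have "(\<integral>\<^sup>+w. (\<Prod>j\<in>J. indicator (B j) (X j w)) \<partial>?P) = (\<integral>\<^sup>+w. (\<Prod>j\<in>J. indicator (B j) (Y j w)) \<partial>?Q)"
  proof (rule insert.IH)
    show "finite_measure ?P" "finite_measure ?Q"
      by (auto intro!: finite_measure_density_bounded[where c=1] insert.prems simp: indicator_def)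
    fix \<phi> assume \<phi>: "\<phi> \<in> J \<rightarrow> \<Phi>"
    have [measurable]: "\<phi> j \<in> borel_measurable borel" if "j \<in> J" for j
      using \<phi> that by (intro \<Phi>m) auto
    show "(\<integral>\<^sup>+w. (\<Prod>j\<in>J. \<phi> j (X j w)) \<partial>?P) = (\<integral>\<^sup>+w. (\<Prod>j\<in>J. \<phi> j (Y j w)) \<partial>?Q)"
      using swap[OF \<phi>] by (simp add: nn_integral_density mult.commute)
  qed (use insert.prems in auto)
  moreover have [measurable]: "B j \<in> sets borel" if "j \<in> J" for j
    using insert.prems that by auto
  ultimately show ?case
    using insert.hyps by (simp add: nn_integral_density mult.commute)
qed

lemma determining_joint_distribution:
  fixes P :: "'w measure" and Q :: "'v measure"
  assumes \<Phi>: "measure_determining \<Phi>"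
    and J: "finite J" and fin: "finite_measure P" "finite_measure Q"
    and meas: "\<And>j. j \<in> J \<Longrightarrow> X j \<in> borel_measurable P" "\<And>j. j \<in> J \<Longrightarrow> Y j \<in> borel_measurable Q"
    and eq: "\<And>\<phi>. \<phi> \<in> J \<rightarrow> \<Phi> \<Longrightarrow>
      (\<integral>\<^sup>+w. (\<Prod>j\<in>J. \<phi> j (X j w)) \<partial>P) = (\<integral>\<^sup>+w. (\<Prod>j\<in>J. \<phi> j (Y j w)) \<partial>Q)"
  shows "distr P (\<Pi>\<^sub>M j\<in>J. borel) (\<lambda>w. \<lambda>j\<in>J. X j w) = distr Q (\<Pi>\<^sub>M j\<in>J. borel) (\<lambda>w. \<lambda>j\<in>J. Y j w)"
proof (rule measure_eqI_PiM_finite[OF J])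
  note [measurable] = meas
  have rect: "emeasure (distr R (\<Pi>\<^sub>M j\<in>J. borel) (\<lambda>w. \<lambda>j\<in>J. V j w)) (Pi\<^sub>E J B) =
      (\<integral>\<^sup>+w. (\<Prod>j\<in>J. indicator (B j) (V j w)) \<partial>R)"
    if [measurable]: "\<And>j. j \<in> J \<Longrightarrow> V j \<in> borel_measurable R" "\<And>j. j \<in> J \<Longrightarrow> B j \<in> sets borel"
    for R :: "'c measure" and V :: "'a \<Rightarrow> 'c \<Rightarrow> real" and B
  proof -
    have [measurable]: "Pi\<^sub>E J B \<in> sets (\<Pi>\<^sub>M j\<in>J. borel)"
      by (intro sets_PiM_I_finite J that)
    have "indicator (Pi\<^sub>E J B) (\<lambda>j\<in>J. V j w) = (\<Prod>j\<in>J. indicator (B j) (V j w) :: ennreal)" for w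
    proof (cases "\<forall>j\<in>J. V j w \<in> B j")
      case False
      then obtain j where j: "j \<in> J" "V j w \<notin> B j" by auto
      then have "(\<Prod>j\<in>J. indicator (B j) (V j w) :: ennreal) = 0"
        using J by (intro prod_zero bexI[of _ j]) auto
      then show ?thesis using j by (auto simp: indicator_def PiE_iff)
    qed (auto simp: indicator_def PiE_iff)
    then show ?thesis
      by (subst nn_integral_indicator[symmetric], simp, subst nn_integral_distr) simp_all
  qed
  show "emeasure (distr P (\<Pi>\<^sub>M j\<in>J. borel) (\<lambda>w. \<lambda>j\<in>J. X j w)) (Pi\<^sub>E J B) =
        emeasure (distr Q (\<Pi>\<^sub>M j\<in>J. borel) (\<lambda>w. \<lambda>j\<in>J. Y j w)) (Pi\<^sub>E J B)"
    if "\<And>j. j \<in> J \<Longrightarrow> B j \<in> sets borel" for B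
    using determining_rectangles[OF \<Phi> J fin meas eq] that by (simp add: rect meas)
  show "range (\<lambda>_::nat. \<Pi>\<^sub>E j\<in>J. UNIV) \<subseteq> prod_algebra J (\<lambda>_. borel :: real measure)"
    using J by (auto intro!: prod_algebraI_finite)
  show "(\<Union>i::nat. \<Pi>\<^sub>E j\<in>J. UNIV) = space (\<Pi>\<^sub>M j\<in>J. (borel :: real measure))"
    by (simp add: space_PiM)
  interpret finite_measure "distr P (\<Pi>\<^sub>M j\<in>J. borel) (\<lambda>w. \<lambda>j\<in>J. X j w)"
    by (rule finite_measure.finite_measure_distr[OF fin(1)]) simp
  show "emeasure (distr P (\<Pi>\<^sub>M j\<in>J. borel) (\<lambda>w. \<lambda>j\<in>J. X j w)) (\<Pi>\<^sub>E j\<in>J. UNIV) \<noteq> \<infinity>" for i :: nat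
    using emeasure_finite by simp
qed simp_all

section \<open>Uniqueness of characteristic and distribution functions\<close>

text \<open>
  The phase \<open>\<tau>\<close> makes a nonnegative family carry the whole characteristic function: \<open>\<theta> = 0\<close> with
  \<open>\<tau> = pi/2\<close> yields the total mass, \<open>\<tau> = 0\<close> the cosine part and \<open>\<tau> = -pi/2\<close> the sine part.
  Levy's uniqueness theorem is for probability measures, hence the normalization by the mass.
\<close>

lemma trig_measure_determining:
  "measure_determining {\<phi>. \<exists>\<theta> \<tau>. \<phi> = (\<lambda>x. ennreal (1 + cos (\<theta> * x + \<tau>)))}"
  unfolding measure_determining_def
proof (intro conjI allI impI ballI; (elim conjE)?)
  fix \<phi> assume "\<phi> \<in> {\<phi>. \<exists>\<theta> \<tau>. \<phi> = (\<lambda>x. ennreal (1 + cos (\<theta> * x + \<tau>)))}"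
  then obtain \<theta> \<tau> where \<phi>: "\<phi> = (\<lambda>x. ennreal (1 + cos (\<theta> * x + \<tau>)))" by auto
  show "\<phi> \<in> borel_measurable borel"
    unfolding \<phi> by measurable
  have "\<phi> x \<le> ennreal 2" for x
    unfolding \<phi> by (intro ennreal_leI) (use cos_le_one[of "\<theta> * x + \<tau>"] in linarith)
  then show "\<exists>c<\<infinity>. \<forall>x. \<phi> x \<le> c"
    by (intro exI[of _ "ennreal 2"]) (simp del: ennreal_numeral)
next
  fix m1 m2 :: "real measure"
  assume m: "finite_borel_measure m1" "finite_borel_measure m2"
    and eq: "\<forall>\<phi>\<in>{\<phi>. \<exists>\<theta> \<tau>. \<phi> = (\<lambda>x. ennreal (1 + cos (\<theta> * x + \<tau>)))}.
      integral\<^sup>N m1 \<phi> = integral\<^sup>N m2 \<phi>"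
  interpret m1: finite_borel_measure m1 by fact
  interpret m2: finite_borel_measure m2 by fact
  note [measurable_cong] = m1.M_is_borel m2.M_is_borel
  have le: "0 \<le> 1 + cos x" for x :: real
    using cos_ge_minus_one[of x] by linarith
  have int: "integrable m (\<lambda>x. cos (\<theta> * x + \<tau>))" if "finite_borel_measure m" for m \<theta> \<tau>
  proof -
    interpret finite_borel_measure m by fact
    note [measurable_cong] = M_is_borel
    show ?thesis
      by (rule integrable_const_bound[of _ 1]) auto
  qed
  have eq': "(LINT x|m1. 1 + cos (\<theta> * x + \<tau>)) = (LINT x|m2. 1 + cos (\<theta> * x + \<tau>))" for \<theta> \<tau>
  proof -
    have "ennreal (LINT x|m1. 1 + cos (\<theta> * x + \<tau>)) = ennreal (LINT x|m2. 1 + cos (\<theta> * x + \<tau>))"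
      using bspec[OF eq, of "\<lambda>x. ennreal (1 + cos (\<theta> * x + \<tau>))"]
      by (subst (1 2) nn_integral_eq_integral[symmetric]) (auto intro!: int m le)
    then show ?thesis
      by (simp add: integral_nonneg_AE le)
  qed
  have mass: "measure m1 UNIV = measure m2 UNIV"
    using eq'[of 0 "pi/2"] by (simp add: m1.borel_UNIV m2.borel_UNIV)
  have trig: "(LINT x|m1. cos (\<theta> * x + \<tau>)) = (LINT x|m2. cos (\<theta> * x + \<tau>))" for \<theta> \<tau>
    using eq'[of \<theta> \<tau>] mass by (simp add: int m m1.borel_UNIV m2.borel_UNIV)
  have char: "(CLINT x|m1. iexp (\<theta> * x)) = (CLINT x|m2. iexp (\<theta> * x))" for \<theta>
  proof (rule complex_eqI)
    have 1: "integrable m1 (\<lambda>x. iexp (\<theta> * x))"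
      by (rule m1.integrable_const_bound[of _ 1]) auto
    have 2: "integrable m2 (\<lambda>x. iexp (\<theta> * x))"
      by (rule m2.integrable_const_bound[of _ 1]) auto
    have Re: "Re (iexp y) = cos y" and Im: "Im (iexp y) = sin y" for y
      by (simp_all add: Re_exp Im_exp)
    show "Re (CLINT x|m1. iexp (\<theta> * x)) = Re (CLINT x|m2. iexp (\<theta> * x))"
      using trig[of \<theta> 0] integral_Re[OF 1] integral_Re[OF 2] unfolding Re by simp
    have sin: "sin x = cos (x + - (pi/2))" for x :: real
      by (simp add: cos_diff)
    show "Im (CLINT x|m1. iexp (\<theta> * x)) = Im (CLINT x|m2. iexp (\<theta> * x))"
      using trig[of \<theta> "-(pi/2)"] integral_Im[OF 1] integral_Im[OF 2] unfolding Im sin by simp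
  qed
  show "m1 = m2"
  proof (cases "measure m1 UNIV = 0")
    case True
    then have "emeasure m1 A = 0" "emeasure m2 A = 0" for A
      using mass m1.bounded_measure[of A] m2.bounded_measure[of A]
      by (simp_all add: m1.emeasure_eq_measure m2.emeasure_eq_measure m1.borel_UNIV m2.borel_UNIV measure_le_0_iff)
    then show ?thesis
      by (intro measure_eqI) (simp_all add: m1.M_is_borel m2.M_is_borel)
  next
    case False
    define c where "c = 1 / measure m1 UNIV"
    have c: "c > 0" "c * measure m1 UNIV = 1" "c * measure m2 UNIV = 1"
      using False mass by (auto simp: c_def zero_less_measure_iff)
    have rd: "real_distribution (density m (\<lambda>_. ennreal c))"
      if "finite_borel_measure m" "c * measure m UNIV = 1" for m
    proof -
      interpret finite_borel_measure m by fact
      have "emeasure (density m (\<lambda>_. ennreal c)) UNIV = 1"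
        using that(2) c(1) M_is_borel
        by (subst emeasure_density_const)
          (auto simp: emeasure_eq_measure ennreal_mult[symmetric])
      then interpret prob_space "density m (\<lambda>_. ennreal c)"
        by (intro prob_spaceI) (simp add: borel_UNIV)
      show ?thesis
        by standard (simp_all add: borel_UNIV M_is_borel)
    qed
    have "density m1 (\<lambda>_. ennreal c) = density m2 (\<lambda>_. ennreal c)"
    proof (rule Levy_uniqueness)
      show "char (density m1 (\<lambda>_. ennreal c)) = char (density m2 (\<lambda>_. ennreal c))"
        using c(1) char by (intro ext) (simp add: char_def integral_density)
    qed (intro rd m c)+
    then have eqd: "emeasure (density m1 (\<lambda>_. ennreal c)) A = emeasure (density m2 (\<lambda>_. ennreal c)) A" for A
      by simp
    have "emeasure m1 A = emeasure m2 A" if "A \<in> sets borel" for A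
    proof -
      have "ennreal c * emeasure m1 A = ennreal c * emeasure m2 A"
        using that eqd[of A] by (simp add: emeasure_density_const m1.M_is_borel m2.M_is_borel)
      then show ?thesis
        using c(1) by (simp add: ennreal_mult_cancel_left)
    qed
    then show ?thesis
      by (intro measure_eqI) (simp_all add: m1.M_is_borel m2.M_is_borel)
  qed
qed

lemma one_plus_cos_exponentials:
  "complex_of_real (1 + cos z) =
     (\<Sum>l\<in>{-1, 0, 1::real}. (if l = 0 then 1 else 1/2) * exp (\<i> * complex_of_real (l * z)))"
  by (simp add: cos_exp_eq cos_of_real[symmetric] field_simps)

text \<open>
  Multivariate uniqueness of characteristic functions, for finite measures. A product over \<open>J\<close> of
  functions \<open>1 + cos (\<theta> x + \<tau>)\<close> is a finite linear combination of exponentials in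
  \<open>\<Sum>j\<in>J. a j * X j\<close>, so its integral is known, and the products of trigonometric test functions
  determine the joint distribution.
\<close>

theorem joint_distribution_eqI_fourier:
  fixes P :: "'w measure" and Q :: "'v measure"
    and X :: "'j \<Rightarrow> 'w \<Rightarrow> real" and Y :: "'j \<Rightarrow> 'v \<Rightarrow> real"
  assumes J: "finite J" and fin: "finite_measure P" "finite_measure Q"
    and meas: "\<And>j. j \<in> J \<Longrightarrow> X j \<in> borel_measurable P" "\<And>j. j \<in> J \<Longrightarrow> Y j \<in> borel_measurable Q"
    and eq: "\<And>a. (LINT w|P. exp (\<i> * complex_of_real (\<Sum>j\<in>J. a j * X j w))) =
                  (LINT w|Q. exp (\<i> * complex_of_real (\<Sum>j\<in>J. a j * Y j w)))"
  shows "distr P (\<Pi>\<^sub>M j\<in>J. borel) (\<lambda>w. \<lambda>j\<in>J. X j w) = distr Q (\<Pi>\<^sub>M j\<in>J. borel) (\<lambda>w. \<lambda>j\<in>J. Y j w)"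
proof (rule determining_joint_distribution[OF trig_measure_determining J fin meas])
  fix \<phi> assume "\<phi> \<in> J \<rightarrow> {\<phi>. \<exists>\<theta> \<tau>. \<phi> = (\<lambda>x. ennreal (1 + cos (\<theta> * x + \<tau>)))}"
  then have "\<forall>j\<in>J. \<exists>\<theta> \<tau>. \<phi> j = (\<lambda>x. ennreal (1 + cos (\<theta> * x + \<tau>)))" by auto
  then obtain \<theta> \<tau> where \<phi>: "\<phi> j = (\<lambda>x. ennreal (1 + cos (\<theta> j * x + \<tau> j)))" if "j \<in> J" for j
    by metis
  define c :: "real \<Rightarrow> complex" where "c l = (if l = 0 then 1 else 1/2)" for l
  define \<L> where "\<L> = (\<Pi>\<^sub>E j\<in>J. {-1, 0, 1::real})"
  define C where "C g = (\<Prod>j\<in>J. c (g j) * exp (\<i> * complex_of_real (g j * \<tau> j)))" for g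
  have le: "0 \<le> 1 + cos x" for x :: real
    using cos_ge_minus_one[of x] by linarith
  have le2: "\<bar>1 + cos x\<bar> \<le> 2" for x :: real
    using cos_ge_minus_one[of x] cos_le_one[of x] by linarith
  have expand: "complex_of_real (\<Prod>j\<in>J. 1 + cos (\<theta> j * x j + \<tau> j)) =
      (\<Sum>g\<in>\<L>. C g * exp (\<i> * complex_of_real (\<Sum>j\<in>J. g j * \<theta> j * x j)))" for x
  proof -
    have "complex_of_real (\<Prod>j\<in>J. 1 + cos (\<theta> j * x j + \<tau> j)) =
        (\<Prod>j\<in>J. \<Sum>l\<in>{-1, 0, 1::real}. c l * exp (\<i> * complex_of_real (l * (\<theta> j * x j + \<tau> j))))"
      unfolding of_real_prod one_plus_cos_exponentials c_def ..
    also have "\<dots> = (\<Sum>g\<in>\<L>. \<Prod>j\<in>J. c (g j) * exp (\<i> * complex_of_real (g j * (\<theta> j * x j + \<tau> j))))"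
      unfolding \<L>_def by (rule prod_sum_PiE) (use J in auto)
    also have "\<dots> = (\<Sum>g\<in>\<L>. C g * exp (\<i> * complex_of_real (\<Sum>j\<in>J. g j * \<theta> j * x j)))"
    proof (rule sum.cong)
      fix g assume "g \<in> \<L>"
      have "exp (\<i> * complex_of_real (\<Sum>j\<in>J. g j * \<theta> j * x j)) =
          (\<Prod>j\<in>J. exp (\<i> * complex_of_real (g j * \<theta> j * x j)))"
        by (simp add: of_real_sum sum_distrib_left exp_sum[OF J])
      then show "(\<Prod>j\<in>J. c (g j) * exp (\<i> * complex_of_real (g j * (\<theta> j * x j + \<tau> j)))) =
          C g * exp (\<i> * complex_of_real (\<Sum>j\<in>J. g j * \<theta> j * x j))"
        by (simp add: C_def prod.distrib[symmetric] exp_add[symmetric] algebra_simps)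
    qed simp
    finally show ?thesis .
  qed
  have lhs: "(\<integral>\<^sup>+w. (\<Prod>j\<in>J. \<phi> j (V j w)) \<partial>R) =
      ennreal (LINT w|R. (\<Prod>j\<in>J. 1 + cos (\<theta> j * V j w + \<tau> j)))"
    and cplx: "complex_of_real (LINT w|R. (\<Prod>j\<in>J. 1 + cos (\<theta> j * V j w + \<tau> j))) =
      (\<Sum>g\<in>\<L>. C g * (LINT w|R. exp (\<i> * complex_of_real (\<Sum>j\<in>J. (g j * \<theta> j) * V j w))))"
    if "finite_measure R" and [measurable]: "\<And>j. j \<in> J \<Longrightarrow> V j \<in> borel_measurable R"
    for R :: "'c measure" and V
  proof -
    interpret finite_measure R by fact
    have int: "integrable R (\<lambda>w. (\<Prod>j\<in>J. 1 + cos (\<theta> j * V j w + \<tau> j)))"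
    proof (rule integrable_const_bound)
      show "AE w in R. norm (\<Prod>j\<in>J. 1 + cos (\<theta> j * V j w + \<tau> j)) \<le> (\<Prod>j\<in>J. 2)"
        unfolding prod_norm[symmetric] by (intro AE_I2 prod_mono) (simp add: le2)
    qed measurable
    have "(\<integral>\<^sup>+w. (\<Prod>j\<in>J. \<phi> j (V j w)) \<partial>R) = (\<integral>\<^sup>+w. ennreal (\<Prod>j\<in>J. 1 + cos (\<theta> j * V j w + \<tau> j)) \<partial>R)"
      by (intro nn_integral_cong) (simp add: \<phi> prod_ennreal le)
    also have "\<dots> = ennreal (LINT w|R. (\<Prod>j\<in>J. 1 + cos (\<theta> j * V j w + \<tau> j)))"
      by (intro nn_integral_eq_integral int AE_I2 prod_nonneg le)
    finally show "(\<integral>\<^sup>+w. (\<Prod>j\<in>J. \<phi> j (V j w)) \<partial>R) =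
      ennreal (LINT w|R. (\<Prod>j\<in>J. 1 + cos (\<theta> j * V j w + \<tau> j)))" .
    have int': "integrable R (\<lambda>w. exp (\<i> * complex_of_real (\<Sum>j\<in>J. a j * V j w)))" for a
      by (rule integrable_const_bound[of _ 1]) auto
    show "complex_of_real (LINT w|R. (\<Prod>j\<in>J. 1 + cos (\<theta> j * V j w + \<tau> j))) =
      (\<Sum>g\<in>\<L>. C g * (LINT w|R. exp (\<i> * complex_of_real (\<Sum>j\<in>J. (g j * \<theta> j) * V j w))))"
      unfolding integral_complex_of_real[symmetric] expand
      by (subst Bochner_Integration.integral_sum)
        (intro integrable_mult_right int', simp only: integral_mult_right_zero)
  qed
  have "complex_of_real (LINT w|P. (\<Prod>j\<in>J. 1 + cos (\<theta> j * X j w + \<tau> j))) =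
      complex_of_real (LINT w|Q. (\<Prod>j\<in>J. 1 + cos (\<theta> j * Y j w + \<tau> j)))"
    using eq by (simp only: cplx fin meas)
  then show "(\<integral>\<^sup>+w. (\<Prod>j\<in>J. \<phi> j (X j w)) \<partial>P) = (\<integral>\<^sup>+w. (\<Prod>j\<in>J. \<phi> j (Y j w)) \<partial>Q)"
    by (simp only: lhs fin meas of_real_eq_iff)
qed

text \<open>
  The level \<open>0\<close> is left out because for nonnegative variables the distribution function is only
  prescribed at positive levels; right-continuity recovers the missing value.
\<close>

lemma cdf_measure_determining: "measure_determining {\<phi>. \<exists>a. a \<noteq> 0 \<and> \<phi> = indicator {..a::real}}"
  unfolding measure_determining_def
proof (intro conjI allI impI ballI; (elim conjE)?)
  fix \<phi> :: "real \<Rightarrow> ennreal" assume "\<phi> \<in> {\<phi>. \<exists>a. a \<noteq> 0 \<and> \<phi> = indicator {..a::real}}"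
  then obtain a where \<phi>: "\<phi> = indicator {..a::real}" by auto
  show "\<phi> \<in> borel_measurable borel"
    unfolding \<phi> by measurable
  show "\<exists>c<\<infinity>. \<forall>x. \<phi> x \<le> c"
    unfolding \<phi> by (intro exI[of _ 1]) (simp add: indicator_def)
next
  fix m1 m2 :: "real measure"
  assume m: "finite_borel_measure m1" "finite_borel_measure m2"
    and eq: "\<forall>\<phi>\<in>{\<phi>. \<exists>a. a \<noteq> 0 \<and> \<phi> = indicator {..a::real}}. integral\<^sup>N m1 \<phi> = integral\<^sup>N m2 \<phi>"
  interpret m1: finite_borel_measure m1 by fact
  interpret m2: finite_borel_measure m2 by fact
  have eq': "cdf m1 a = cdf m2 a" if "a \<noteq> 0" for a
  proof -
    have "integral\<^sup>N m1 (indicator {..a}) = integral\<^sup>N m2 (indicator {..a})"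
      using that by (intro bspec[OF eq]) auto
    then show ?thesis
      by (simp add: cdf_def measure_def m1.M_is_borel m2.M_is_borel)
  qed
  have "(cdf m1 \<longlongrightarrow> cdf m1 0) (at_right 0)" "(cdf m2 \<longlongrightarrow> cdf m2 0) (at_right 0)"
    using m1.cdf_is_right_cont m2.cdf_is_right_cont by (auto simp: continuous_within)
  moreover have "(cdf m1 \<longlongrightarrow> l) (at_right 0) \<longleftrightarrow> (cdf m2 \<longlongrightarrow> l) (at_right 0)" for l
    by (intro tendsto_cong) (auto simp: eventually_at_filter eq')
  ultimately have "cdf m1 0 = cdf m2 0"
    using tendsto_unique[OF trivial_limit_at_right_real] by blast
  then have "cdf m1 = cdf m2"
    using eq' by (intro ext) metis
  then show "m1 = m2"
    by (rule cdf_unique'[OF m])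
qed

lemma prod_indicator_atMost:
  assumes "finite J"
  shows "(\<Prod>j\<in>J. indicator {..a j} (x j) :: ennreal) = (if \<forall>j\<in>J. x j \<le> a j then 1 else 0)"
proof (cases "\<forall>j\<in>J. x j \<le> a j")
  case False
  then obtain j where "j \<in> J" "\<not> x j \<le> a j" by auto
  then have "(\<Prod>j\<in>J. indicator {..a j} (x j) :: ennreal) = 0"
    using assms by (intro prod_zero bexI[of _ j]) auto
  then show ?thesis using False by simp
qed simp

text \<open>
  Nonnegative vectors have zero mass below a level vector with a negative
  entry, so boxes with positive corners supply the integrals of all products of indicators
  \<open>{..a}\<close> with \<open>a \<noteq> 0\<close>.
\<close>

theorem joint_distribution_eqI_cdf:
  fixes P :: "'w measure" and Q :: "'v measure"
    and X :: "'j \<Rightarrow> 'w \<Rightarrow> real" and Y :: "'j \<Rightarrow> 'v \<Rightarrow> real"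
  assumes J: "finite J" and fin: "finite_measure P" "finite_measure Q"
    and meas: "\<And>j. j \<in> J \<Longrightarrow> X j \<in> borel_measurable P" "\<And>j. j \<in> J \<Longrightarrow> Y j \<in> borel_measurable Q"
    and nonneg: "\<And>j. j \<in> J \<Longrightarrow> AE w in P. 0 \<le> X j w" "\<And>j. j \<in> J \<Longrightarrow> AE w in Q. 0 \<le> Y j w"
    and eq: "\<And>a. (\<And>j. j \<in> J \<Longrightarrow> 0 < a j) \<Longrightarrow>
      emeasure P {w\<in>space P. \<forall>j\<in>J. X j w \<le> a j} = emeasure Q {w\<in>space Q. \<forall>j\<in>J. Y j w \<le> a j}"
  shows "distr P (\<Pi>\<^sub>M j\<in>J. borel) (\<lambda>w. \<lambda>j\<in>J. X j w) = distr Q (\<Pi>\<^sub>M j\<in>J. borel) (\<lambda>w. \<lambda>j\<in>J. Y j w)"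
proof (rule determining_joint_distribution[OF cdf_measure_determining J fin meas])
  fix \<phi> :: "'j \<Rightarrow> real \<Rightarrow> ennreal" assume "\<phi> \<in> J \<rightarrow> {\<phi>. \<exists>a. a \<noteq> 0 \<and> \<phi> = indicator {..a::real}}"
  then have "\<forall>j\<in>J. \<exists>a. a \<noteq> 0 \<and> \<phi> j = indicator {..a}" by auto
  then obtain a where \<phi>: "a j \<noteq> 0" "\<phi> j = indicator {..a j}" if "j \<in> J" for j
    by metis
  have conv: "(\<integral>\<^sup>+w. (\<Prod>j\<in>J. \<phi> j (V j w)) \<partial>R) = emeasure R {w\<in>space R. \<forall>j\<in>J. V j w \<le> a j}"
    if [measurable]: "\<And>j. j \<in> J \<Longrightarrow> V j \<in> borel_measurable R" for R :: "'c measure" and V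
  proof -
    have "(\<integral>\<^sup>+w. (\<Prod>j\<in>J. \<phi> j (V j w)) \<partial>R) = (\<integral>\<^sup>+w. indicator {w\<in>space R. \<forall>j\<in>J. V j w \<le> a j} w \<partial>R)"
      by (intro nn_integral_cong) (simp add: \<phi> prod_indicator_atMost[OF J] indicator_def J)
    also have "\<dots> = emeasure R {w\<in>space R. \<forall>j\<in>J. V j w \<le> a j}"
      using J by (intro nn_integral_indicator) measurable
    finally show ?thesis .
  qed
  have zero: "emeasure R {w\<in>space R. \<forall>j\<in>J. V j w \<le> a j} = 0"
    if "k \<in> J" "a k < 0" "AE w in R. 0 \<le> V k w" for R :: "'c measure" and V k
  proof -
    have "AE w in R. \<not> (\<forall>j\<in>J. V j w \<le> a j)"
      using that(3) by eventually_elim (use that in force)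
    then show ?thesis
      by (rule emeasure_eq_0_AE)
  qed
  have "emeasure P {w\<in>space P. \<forall>j\<in>J. X j w \<le> a j} = emeasure Q {w\<in>space Q. \<forall>j\<in>J. Y j w \<le> a j}"
  proof (cases "\<forall>j\<in>J. 0 < a j")
    case False
    then obtain k where "k \<in> J" "a k < 0"
      using \<phi>(1) by force
    then show ?thesis
      using zero[of k X P] zero[of k Y Q] nonneg by simp
  qed (use eq in auto)
  then show "(\<integral>\<^sup>+w. (\<Prod>j\<in>J. \<phi> j (X j w)) \<partial>P) = (\<integral>\<^sup>+w. (\<Prod>j\<in>J. \<phi> j (Y j w)) \<partial>Q)"
    by (simp add: conv meas)
qed

section \<open>The homogeneous Levy measure of a family of functions\<close>

text \<open>
  The density of the symmetric \<open>\<alpha>\<close>-stable Levy measure on the line. Its value at \<open>r = 0\<close> is \<open>0\<close>,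
  by the convention for \<open>powr\<close>.
\<close>

definition levy_density :: "real \<Rightarrow> real \<Rightarrow> ennreal" where
  "levy_density \<alpha> r = ennreal (\<bar>r\<bar> powr (- 1 - \<alpha>))"

text \<open>
  For functions \<open>g j\<close> on \<open>M\<close>, the image of this measure under \<open>(s, r) \<mapsto> (r * g j s)\<^sub>j\<close> is, up to a
  constant, the Levy measure of the stable vector of integrals of the \<open>g j\<close>. Its part with \<open>r > 0\<close>
  is the exponent measure of the Frechet vector. Both radial directions are kept because
  the symmetry in \<open>r\<close> makes sine transforms vanish.
\<close>

definition levy_measure :: "real \<Rightarrow> 'a measure \<Rightarrow> ('a \<times> real) measure" where
  "levy_measure \<alpha> M = density (M \<Otimes>\<^sub>M lborel) (\<lambda>(s, r). levy_density \<alpha> r)"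

lemma measurable_levy_density [measurable]: "levy_density \<alpha> \<in> borel_measurable borel"
  unfolding levy_density_def by measurable

lemma sets_levy_measure [measurable_cong]: "sets (levy_measure \<alpha> M) = sets (M \<Otimes>\<^sub>M lborel)"
  by (simp add: levy_measure_def)

lemma space_levy_measure: "space (levy_measure \<alpha> M) = space M \<times> UNIV"
  by (simp add: levy_measure_def space_pair_measure)

lemma nn_integral_levy_measure:
  assumes [measurable]: "f \<in> borel_measurable (M \<Otimes>\<^sub>M lborel)"
  shows "(\<integral>\<^sup>+z. f z \<partial>levy_measure \<alpha> M) =
    (\<integral>\<^sup>+s. (\<integral>\<^sup>+r. levy_density \<alpha> r * f (s, r) \<partial>lborel) \<partial>M)"
proof -
  have "(\<integral>\<^sup>+z. f z \<partial>levy_measure \<alpha> M) = (\<integral>\<^sup>+z. (case z of (s, r) \<Rightarrow> levy_density \<alpha> r) * f z \<partial>(M \<Otimes>\<^sub>M lborel))"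
    unfolding levy_measure_def by (rule nn_integral_density) measurable
  also have "\<dots> = (\<integral>\<^sup>+s. (\<integral>\<^sup>+r. (case (s, r) of (s, r) \<Rightarrow> levy_density \<alpha> r) * f (s, r) \<partial>lborel) \<partial>M)"
    by (rule lborel.nn_integral_fst[symmetric]) measurable
  finally show ?thesis by simp
qed

definition levy_integral :: "real \<Rightarrow> (real \<Rightarrow> ennreal) \<Rightarrow> ennreal" where
  "levy_integral \<alpha> h = (\<integral>\<^sup>+r. levy_density \<alpha> r * h r \<partial>lborel)"

text \<open>
  The substitution \<open>r \<mapsto> c * r\<close> takes the homogeneous density to a multiple of itself. Every radial
  functional therefore has the same dependence \<open>\<bar>c\<bar> powr \<alpha>\<close> on the scale, whatever \<open>h\<close> is; this is
  the common source of the stable and of the Frechet exponent.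
\<close>

lemma levy_integral_scale:
  assumes [measurable]: "h \<in> borel_measurable borel" and h0: "h 0 = 0"
  shows "(\<integral>\<^sup>+r. levy_density \<alpha> r * h (r * c) \<partial>lborel) = levy_integral \<alpha> h * ennreal (\<bar>c\<bar> powr \<alpha>)"
proof (cases "c = 0")
  case True
  then show ?thesis by (simp add: h0)
next
  case False
  have "levy_integral \<alpha> h = ennreal \<bar>c\<bar> * (\<integral>\<^sup>+r. levy_density \<alpha> (c * r) * h (c * r) \<partial>lborel)"
    unfolding levy_integral_def using False by (subst nn_integral_real_affine[of _ c 0]) auto
  also have "\<dots> = ennreal \<bar>c\<bar> * (\<integral>\<^sup>+r. ennreal (\<bar>c\<bar> powr (- 1 - \<alpha>)) * (levy_density \<alpha> r * h (r * c)) \<partial>lborel)"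
    by (simp add: levy_density_def abs_mult powr_mult ennreal_mult mult_ac)
  also have "\<dots> = ennreal (\<bar>c\<bar> * \<bar>c\<bar> powr (- 1 - \<alpha>)) * (\<integral>\<^sup>+r. levy_density \<alpha> r * h (r * c) \<partial>lborel)"
    by (subst nn_integral_cmult) (auto simp: ennreal_mult mult_ac)
  finally have eq: "levy_integral \<alpha> h = ennreal (\<bar>c\<bar> * \<bar>c\<bar> powr (- 1 - \<alpha>)) * (\<integral>\<^sup>+r. levy_density \<alpha> r * h (r * c) \<partial>lborel)" .
  have "\<bar>c\<bar> powr \<alpha> * (\<bar>c\<bar> * \<bar>c\<bar> powr (- 1 - \<alpha>)) = \<bar>c\<bar> powr \<alpha> * (\<bar>c\<bar> powr 1 * \<bar>c\<bar> powr (- 1 - \<alpha>))"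
    by simp
  also have "\<dots> = 1"
    using False unfolding powr_add[symmetric] by simp
  finally have "ennreal (\<bar>c\<bar> powr \<alpha>) * ennreal (\<bar>c\<bar> * \<bar>c\<bar> powr (- 1 - \<alpha>)) = 1"
    by (simp flip: ennreal_mult)
  then show ?thesis
    unfolding eq by (simp add: mult.commute mult.left_commute flip: mult.assoc)
qed

lemma nn_integral_levy_measure_radial:
  assumes [measurable]: "h \<in> borel_measurable borel" "F \<in> borel_measurable M" and h0: "h 0 = 0"
  shows "(\<integral>\<^sup>+(s, r). h (r * F s) \<partial>levy_measure \<alpha> M) = levy_integral \<alpha> h * (\<integral>\<^sup>+s. ennreal (\<bar>F s\<bar> powr \<alpha>) \<partial>M)"
proof -
  have "(\<integral>\<^sup>+(s, r). h (r * F s) \<partial>levy_measure \<alpha> M) = (\<integral>\<^sup>+s. levy_integral \<alpha> h * ennreal (\<bar>F s\<bar> powr \<alpha>) \<partial>M)"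
    by (subst nn_integral_levy_measure) (auto simp: levy_integral_scale h0)
  also have "\<dots> = levy_integral \<alpha> h * (\<integral>\<^sup>+s. ennreal (\<bar>F s\<bar> powr \<alpha>) \<partial>M)"
    by (rule nn_integral_cmult) measurable
  finally show ?thesis .
qed

text \<open>
  The bound by \<open>r\<^sup>2\<close> near the origin is integrable against the density because \<open>\<alpha> < 2\<close>, the constant
  bound at infinity because \<open>0 < \<alpha>\<close>.
\<close>

lemma levy_integral_finite:
  assumes \<alpha>: "0 < \<alpha>" "\<alpha> < 2"
    and le: "\<And>r. h r \<le> ennreal (min 2 (r^2))"
  shows "levy_integral \<alpha> h < \<infinity>"
proof -
  define k :: "real \<Rightarrow> ennreal" where
    "k r = ennreal (r powr (1 - \<alpha>)) * indicator {0..1} r + ennreal (2 * r powr (- 1 - \<alpha>)) * indicator {1..} r" for r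
  have [measurable]: "k \<in> borel_measurable borel"
    unfolding k_def by measurable
  have "((\<lambda>r. r powr (1 - \<alpha>)) has_integral (1 powr (1 - \<alpha> + 1) / (1 - \<alpha> + 1))) {0..1}"
    using \<alpha> by (intro has_integral_powr_from_0) auto
  then have 1: "(\<integral>\<^sup>+r. ennreal (r powr (1 - \<alpha>)) * indicator {0..1} r \<partial>lborel) < \<infinity>"
    by (subst nn_integral_has_integral_lebesgue') auto
  have "((\<lambda>r. 2 * r powr (- 1 - \<alpha>)) has_integral (2 * (- (1 powr (- 1 - \<alpha> + 1)) / (- 1 - \<alpha> + 1)))) {1..}"
    using \<alpha> by (intro has_integral_mult_right has_integral_powr_to_inf) auto
  then have 2: "(\<integral>\<^sup>+r. ennreal (2 * r powr (- 1 - \<alpha>)) * indicator {1..} r \<partial>lborel) < \<infinity>"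
    by (subst nn_integral_has_integral_lebesgue') auto
  have k: "(\<integral>\<^sup>+r. k r \<partial>lborel) < \<infinity>"
    using 1 2 unfolding k_def by (subst nn_integral_add) auto
  have pos: "levy_density \<alpha> r * ennreal (min 2 (r^2)) \<le> k r" if r0: "0 \<le> r" for r
  proof -
    consider "r = 0" | "0 < r" "r \<le> 1" | "1 < r" using r0 by linarith
    then show ?thesis
    proof cases
      case 2
      have "r powr (- 1 - \<alpha>) * min 2 (r^2) \<le> r powr (- 1 - \<alpha>) * r powr 2"
        using 2 by (intro mult_left_mono) (auto simp: powr_numeral)
      also have "\<dots> = r powr (1 - \<alpha>)"
        by (simp flip: powr_add)
      finally have "levy_density \<alpha> r * ennreal (min 2 (r^2)) \<le> ennreal (r powr (1 - \<alpha>))"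
        using 2 by (simp add: levy_density_def ennreal_leI flip: ennreal_mult)
      then show ?thesis
        using 2 by (auto simp: k_def indicator_def add_increasing2)
    next
      case 3
      have "r powr (- 1 - \<alpha>) * min 2 (r^2) \<le> r powr (- 1 - \<alpha>) * 2"
        by (intro mult_left_mono) auto
      then show ?thesis
        using 3 by (simp add: k_def levy_density_def ennreal_leI mult.commute flip: ennreal_mult)
    qed (simp add: levy_density_def)
  qed
  \<comment> \<open>The function \<open>k\<close> lives on the positive half line; its reflection covers the negative one.\<close>
  have "levy_density \<alpha> r * h r \<le> k r + k (0 + (-1) * r)" for r
  proof -
    have "levy_density \<alpha> r * h r \<le> levy_density \<alpha> r * ennreal (min 2 (r^2))"
      by (intro mult_left_mono le) auto
    also have "\<dots> = levy_density \<alpha> \<bar>r\<bar> * ennreal (min 2 (\<bar>r\<bar>^2))"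
      by (simp add: levy_density_def)
    also have "\<dots> \<le> k \<bar>r\<bar>"
      by (rule pos) simp
    also have "\<dots> \<le> k r + k (0 + (-1) * r)"
      by (cases "0 \<le> r") (auto simp: add_increasing add_increasing2)
    finally show ?thesis .
  qed
  then have "levy_integral \<alpha> h \<le> (\<integral>\<^sup>+r. k r + k (0 + (-1) * r) \<partial>lborel)"
    unfolding levy_integral_def by (intro nn_integral_mono)
  also have "\<dots> = (\<integral>\<^sup>+r. k r \<partial>lborel) + (\<integral>\<^sup>+r. k r \<partial>lborel)"
    using nn_integral_real_affine[of k "-1" 0] by (subst nn_integral_add) auto
  also have "\<dots> < \<infinity>"
    using k by simp
  finally show ?thesis .
qed

lemma levy_integral_pos:
  assumes [measurable]: "h \<in> borel_measurable borel" and h: "\<And>r. 1 < r \<Longrightarrow> r < 2 \<Longrightarrow> 0 < h r"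
  shows "0 < levy_integral \<alpha> h"
proof (rule ccontr)
  assume "\<not> 0 < levy_integral \<alpha> h"
  then have "AE r in lborel. levy_density \<alpha> r * h r = 0"
    unfolding levy_integral_def by (subst (asm) (1) zero_less_iff_neq_zero) (simp add: nn_integral_0_iff_AE)
  then have "AE r in lborel. r \<notin> {1<..<2::real}"
    by eventually_elim (use h in \<open>force simp: levy_density_def\<close>)
  then have "emeasure lborel {1<..<2::real} = 0"
    by (subst (asm) AE_iff_measurable[of "{1<..<2::real}"]) auto
  then show False by simp
qed

definition stable_constant :: "real \<Rightarrow> ennreal" where
  "stable_constant \<alpha> = levy_integral \<alpha> (\<lambda>r. ennreal (1 - cos r))"

definition frechet_constant :: "real \<Rightarrow> ennreal" where
  "frechet_constant \<alpha> = levy_integral \<alpha> (\<lambda>r. indicator {x. 1 < \<bar>x\<bar>} r)"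

lemma stable_constant:
  assumes "0 < \<alpha>" "\<alpha> < 2"
  shows "stable_constant \<alpha> < \<infinity>" "0 < stable_constant \<alpha>"
proof -
  have "1 - cos r \<le> min 2 (r^2)" for r :: real
  proof -
    have "1 - cos r = 2 * (sin (r / 2))^2"
      using cos_double_sin[of "r / 2"] by simp
    also have "\<dots> \<le> 2 * \<bar>r / 2\<bar>^2"
      using abs_sin_x_le_abs_x[of "r / 2"] by (subst power2_abs[symmetric]) (intro mult_left_mono power_mono; simp)
    also have "\<dots> \<le> r^2"
      by (simp add: power_divide)
    finally show ?thesis
      using cos_ge_minus_one[of r] by auto
  qed
  then show "stable_constant \<alpha> < \<infinity>"
    unfolding stable_constant_def by (intro levy_integral_finite assms ennreal_leI)
  show "0 < stable_constant \<alpha>"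
    unfolding stable_constant_def
  proof (rule levy_integral_pos)
    fix r :: real assume "1 < r" "r < 2"
    then have "cos r < cos 0"
      using pi_gt3 by (intro cos_monotone_0_pi) auto
    then show "0 < ennreal (1 - cos r)" by simp
  qed measurable
qed

lemma frechet_constant:
  assumes "0 < \<alpha>" "\<alpha> < 2"
  shows "frechet_constant \<alpha> < \<infinity>" "0 < frechet_constant \<alpha>"
proof -
  have "indicator {x. 1 < \<bar>x\<bar>} r \<le> ennreal (min 2 (r^2))" for r :: real
  proof (cases "1 < \<bar>r\<bar>")
    case True
    then have "1 \<le> \<bar>r\<bar>^2"
      by (intro one_le_power) simp
    then show ?thesis using True by (simp add: ennreal_leI)
  qed simp
  then show "frechet_constant \<alpha> < \<infinity>"
    unfolding frechet_constant_def by (intro levy_integral_finite assms)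
  show "0 < frechet_constant \<alpha>"
    unfolding frechet_constant_def 
  proof (rule levy_integral_pos)
    have "{x::real. 1 < \<bar>x\<bar>} \<in> sets borel"
      by (intro borel_open open_Collect_less continuous_intros)
    then show "(\<lambda>r. indicator {x::real. 1 < \<bar>x\<bar>} r :: ennreal) \<in> borel_measurable borel"
      by (rule borel_measurable_indicator)
  qed (simp add: indicator_def)
qed

lemma Max_nonneg_image:
  assumes "finite J" "J \<noteq> {}" "\<And>j. j \<in> J \<Longrightarrow> 0 \<le> (u j :: real)"
  shows "0 \<le> (MAX j\<in>J. u j)"
proof -
  obtain j where "j \<in> J" using assms(2) by auto
  then show ?thesis using assms by (intro order_trans[OF assms(3) Max_ge]) auto
qed

lemma levy_measure_one_minus_cos:
  fixes g :: "'t \<Rightarrow> 'a \<Rightarrow> real"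
  assumes [measurable]: "\<And>j. j \<in> J \<Longrightarrow> g j \<in> borel_measurable M"
  shows "(\<integral>\<^sup>+z. ennreal (1 - cos (\<Sum>j\<in>J. b j * (snd z * g j (fst z)))) \<partial>levy_measure \<alpha> M) =
    stable_constant \<alpha> * (\<integral>\<^sup>+s. ennreal (\<bar>\<Sum>j\<in>J. b j * g j s\<bar> powr \<alpha>) \<partial>M)"
proof -
  have "(\<Sum>j\<in>J. b j * (r * g j s)) = r * (\<Sum>j\<in>J. b j * g j s)" for r s
    by (simp add: sum_distrib_left mult_ac)
  then show ?thesis
    unfolding stable_constant_def
    by (subst nn_integral_levy_measure_radial[symmetric]) (auto simp: case_prod_unfold)
qed

text \<open>
  As the \<open>g j\<close> are nonnegative, some \<open>\<bar>r * g j s\<bar>\<close> exceeds \<open>a j\<close> exactly when \<open>\<bar>r\<bar>\<close> times the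
  weighted maximum of the \<open>g j s\<close> exceeds \<open>1\<close>: a radial functional again.
\<close>

lemma levy_measure_exceedance:
  fixes g :: "'t \<Rightarrow> 'a \<Rightarrow> real"
  assumes J: "finite J" "J \<noteq> {}" and [measurable]: "\<And>j. j \<in> J \<Longrightarrow> g j \<in> borel_measurable M"
    and g: "\<And>j s. j \<in> J \<Longrightarrow> 0 \<le> g j s" and a: "\<And>j. j \<in> J \<Longrightarrow> 0 < a j"
  shows "emeasure (levy_measure \<alpha> M) {z\<in>space (levy_measure \<alpha> M). \<exists>j\<in>J. a j < \<bar>snd z * g j (fst z)\<bar>} =
    frechet_constant \<alpha> * (\<integral>\<^sup>+s. ennreal ((MAX j\<in>J. g j s / a j) powr \<alpha>) \<partial>M)"
proof -
  have [measurable]: "(\<lambda>s. MAX j\<in>J. g j s / a j) \<in> borel_measurable M"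
    using J by (intro borel_measurable_Max) auto
  have iff: "(\<exists>j\<in>J. a j < \<bar>r * g j s\<bar>) \<longleftrightarrow> 1 < \<bar>r * (MAX j\<in>J. g j s / a j)\<bar>" for r s
  proof -
    obtain k where k: "k \<in> J" "(MAX j\<in>J. g j s / a j) = g k s / a k"
      using Max_in[of "(\<lambda>j. g j s / a j) ` J"] J by (auto simp del: Max_in)
    have *: "a j < \<bar>r * g j s\<bar> \<longleftrightarrow> 1 < \<bar>r\<bar> * (g j s / a j)" if "j \<in> J" for j
      using a[OF that] g[OF that] by (simp add: field_simps abs_mult)
    have "\<bar>r\<bar> * (g j s / a j) \<le> \<bar>r\<bar> * (MAX j\<in>J. g j s / a j)" if "j \<in> J" for j
      using J that by (intro mult_left_mono Max_ge) auto
    moreover have "\<bar>r * (MAX j\<in>J. g j s / a j)\<bar> = \<bar>r\<bar> * (MAX j\<in>J. g j s / a j)"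
      using Max_nonneg_image[OF J, of "\<lambda>j. g j s / a j"] g a by (simp add: abs_mult less_imp_le)
    ultimately show ?thesis
      using * k(1) unfolding k(2) by (auto intro: less_le_trans)
  qed
  have "emeasure (levy_measure \<alpha> M) {z\<in>space (levy_measure \<alpha> M). \<exists>j\<in>J. a j < \<bar>snd z * g j (fst z)\<bar>} =
      (\<integral>\<^sup>+z. indicator {z\<in>space (levy_measure \<alpha> M). \<exists>j\<in>J. a j < \<bar>snd z * g j (fst z)\<bar>} z \<partial>levy_measure \<alpha> M)"
    using J by (intro nn_integral_indicator[symmetric]) measurable
  also have "\<dots> = (\<integral>\<^sup>+(s, r). indicator {x. 1 < \<bar>x\<bar>} (r * (MAX j\<in>J. g j s / a j)) \<partial>levy_measure \<alpha> M)"
    by (intro nn_integral_cong) (auto simp: indicator_def iff)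
  also have "\<dots> = frechet_constant \<alpha> * (\<integral>\<^sup>+s. ennreal (\<bar>MAX j\<in>J. g j s / a j\<bar> powr \<alpha>) \<partial>M)"
    unfolding frechet_constant_def by (rule nn_integral_levy_measure_radial) auto
  also have "(\<integral>\<^sup>+s. ennreal (\<bar>MAX j\<in>J. g j s / a j\<bar> powr \<alpha>) \<partial>M) = (\<integral>\<^sup>+s. ennreal ((MAX j\<in>J. g j s / a j) powr \<alpha>) \<partial>M)"
    using Max_nonneg_image[OF J] g a by (intro nn_integral_cong) (simp add: less_imp_le)
  finally show ?thesis .
qed

lemma levy_measure_reflection:
  "distr (levy_measure \<alpha> M) (levy_measure \<alpha> M) (\<lambda>z. (fst z, - snd z)) = levy_measure \<alpha> M"
proof (rule measure_eqI)
  fix A assume "A \<in> sets (distr (levy_measure \<alpha> M) (levy_measure \<alpha> M) (\<lambda>z. (fst z, - snd z)))"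
  then have A: "A \<in> sets (M \<Otimes>\<^sub>M lborel)"
    by (simp add: sets_levy_measure)
  note [measurable] = A
  have A': "A \<in> sets (levy_measure \<alpha> M)"
    using A by (simp add: sets_levy_measure)
  have "emeasure (distr (levy_measure \<alpha> M) (levy_measure \<alpha> M) (\<lambda>z. (fst z, - snd z))) A =
      (\<integral>\<^sup>+z. indicator A (fst z, - snd z) \<partial>levy_measure \<alpha> M)"
    using A' by (subst nn_integral_indicator[symmetric]) (simp, subst nn_integral_distr, auto)
  also have "\<dots> = (\<integral>\<^sup>+s. (\<integral>\<^sup>+r. levy_density \<alpha> r * indicator A (s, - r) \<partial>lborel) \<partial>M)"
    by (subst nn_integral_levy_measure) auto
  also have "\<dots> = (\<integral>\<^sup>+s. (\<integral>\<^sup>+r. levy_density \<alpha> r * indicator A (s, r) \<partial>lborel) \<partial>M)"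
  proof (rule nn_integral_cong)
    fix s assume [measurable]: "s \<in> space M"
    show "(\<integral>\<^sup>+r. levy_density \<alpha> r * indicator A (s, - r) \<partial>lborel) = (\<integral>\<^sup>+r. levy_density \<alpha> r * indicator A (s, r) \<partial>lborel)"
      by (subst (2) nn_integral_real_affine[of _ "-1" 0]) (auto simp: levy_density_def)
  qed
  also have "\<dots> = (\<integral>\<^sup>+z. indicator A z \<partial>levy_measure \<alpha> M)"
    by (subst nn_integral_levy_measure) auto
  finally show "emeasure (distr (levy_measure \<alpha> M) (levy_measure \<alpha> M) (\<lambda>z. (fst z, - snd z))) A = emeasure (levy_measure \<alpha> M) A"
    using A' by simp
qed simp

section \<open>Cosine integrals and exceedance masses determine each other\<close>

text \<open>
  The weight \<open>1 - cos x\<close> also vanishes at the nonzero multiples of \<open>2 * pi\<close>. A second cosine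
  with an incommensurable frequency removes these zeros.
\<close>

lemma irrational_scale_separates:
  assumes q: "q \<notin> \<rat>" and x: "cos x = 1" "cos (q * x) = 1"
  shows "x = (0 :: real)"
proof (rule ccontr)
  assume "x \<noteq> 0"
  obtain m n :: int where m: "x = real_of_int m * 2 * pi" and n: "q * x = real_of_int n * 2 * pi"
    using x unfolding cos_one_2pi_int by blast
  have "m \<noteq> 0" using m \<open>x \<noteq> 0\<close> by auto
  then have "q = of_int n / of_int m"
    using n unfolding m by (simp add: field_simps)
  then show False using q by simp
qed

text \<open>
  For irrational \<open>q\<close>, a combination of terms \<open>1 - cos\<close> that vanishes only at the origin. It turns the possibly infinite
  Levy measure into a finite measure that still charges every exceedance set.
\<close>

definition fourier_weight :: "real \<Rightarrow> 't set \<Rightarrow> ('t \<Rightarrow> real) \<Rightarrow> real" where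
  "fourier_weight q J v = (\<Sum>(k, p)\<in>J \<times> {1, q}. 1 - cos (p * v k))"

lemma fourier_weight_nonneg: "0 \<le> fourier_weight q J v"
  unfolding fourier_weight_def by (intro sum_nonneg) (auto simp: split_beta)

lemma fourier_weight_pos:
  assumes "finite J" "q \<notin> \<rat>" "k \<in> J" "v k \<noteq> 0"
  shows "0 < fourier_weight q J v"
proof -
  have "cos (1 * v k) \<noteq> 1 \<or> cos (q * v k) \<noteq> 1"
    using irrational_scale_separates[of q "v k"] assms by auto
  then obtain p where p: "p \<in> {1, q}" "cos (p * v k) \<noteq> 1" by blast
  then have "0 < (case (k, p) of (k, p) \<Rightarrow> 1 - cos (p * v k))"
    using cos_le_one[of "p * v k"] p(2) by (simp add: less_le)
  then show ?thesis
    unfolding fourier_weight_def using assms p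
    by (intro sum_pos2[of _ "(k, p)"]) (auto simp: split_beta)
qed

text \<open>
  By \<open>2 (1 - cos u) cos v = (1 - cos (v + u)) + (1 - cos (v - u)) - 2 (1 - cos v)\<close>, the cosine
  transform of the weighted measure is a second difference of the integrals \<open>I\<close>. The sine transform
  vanishes, because the reflection \<open>\<tau>\<close> preserves \<open>N\<close> and reverses all \<open>y j\<close>. Hence the integrals
  of \<open>1 - cos\<close> determine the weighted measure through its characteristic function.
\<close>

lemma weighted_fourier_transform:
  fixes q :: real and y :: "'t \<Rightarrow> 'n \<Rightarrow> real"
  assumes J: "finite J" and [measurable]: "\<And>j. j \<in> J \<Longrightarrow> y j \<in> borel_measurable N"
    and fin: "\<And>b. (\<integral>\<^sup>+z. ennreal (1 - cos (\<Sum>j\<in>J. b j * y j z)) \<partial>N) < \<infinity>"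
    and \<tau>: "\<tau> \<in> N \<rightarrow>\<^sub>M N" "distr N N \<tau> = N" "\<And>j z. y j (\<tau> z) = - y j z"
  defines "I \<equiv> \<lambda>b. (LINT z|N. 1 - cos (\<Sum>j\<in>J. b j * y j z))"
    and "\<delta> \<equiv> \<lambda>k p j. if j = k then p else (0::real)"
    and "D \<equiv> density N (\<lambda>z. ennreal (fourier_weight q J (\<lambda>j. y j z)))"
  shows "finite_measure D"
    and "(LINT z|D. exp (\<i> * complex_of_real (\<Sum>j\<in>J. a j * y j z))) =
      complex_of_real (\<Sum>(k, p)\<in>J \<times> {1, q}. (I (\<lambda>j. a j + \<delta> k p j) + I (\<lambda>j. a j - \<delta> k p j) - 2 * I a) / 2)"
proof -
  note [measurable] = \<tau>(1)
  let ?c = "\<lambda>b z. \<Sum>j\<in>J. b j * y j z"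
  let ?w = "\<lambda>z. fourier_weight q J (\<lambda>j. y j z)"
  have int: "integrable N (\<lambda>z. 1 - cos (?c b z))" for b
    by (rule integrableI_nonneg) (use fin[of b] in auto)
  have \<delta>: "?c (\<delta> k p) z = p * y k z" if "k \<in> J" for k p z
    using J that by (simp add: \<delta>_def if_distrib[of "\<lambda>x. x * _"] cong: if_cong)
  have w: "?w z = (\<Sum>(k, p)\<in>J \<times> {1, q}. 1 - cos (?c (\<delta> k p) z))" for z
    unfolding fourier_weight_def by (intro sum.cong) (auto simp: \<delta>)
  have w_int: "integrable N ?w"
    unfolding w split_beta by (intro Bochner_Integration.integrable_sum int)
  have [measurable]: "?w \<in> borel_measurable N"
    using w_int by auto
  show "finite_measure D"
  proof (rule finite_measureI)
    have "emeasure D (space D) = (\<integral>\<^sup>+z. ennreal (?w z) \<partial>N)"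
      unfolding D_def by (simp add: emeasure_density cong: nn_integral_cong)
    also have "\<dots> = ennreal (LINT z|N. ?w z)"
      by (intro nn_integral_eq_integral w_int AE_I2 fourier_weight_nonneg)
    finally show "emeasure D (space D) \<noteq> \<infinity>" by simp
  qed
  have cos_int: "integrable N (\<lambda>z. ?w z * cos (?c a z))"
    by (rule Bochner_Integration.integrable_bound[OF w_int])
      (auto simp: abs_mult fourier_weight_nonneg intro!: mult_left_le AE_I2)
  have sin_int: "integrable N (\<lambda>z. ?w z * sin (?c a z))"
    by (rule Bochner_Integration.integrable_bound[OF w_int])
      (auto simp: abs_mult fourier_weight_nonneg intro!: mult_left_le AE_I2)
  have product: "(1 - cos (?c (\<delta> k p) z)) * cos (?c a z) =
      ((1 - cos (?c (\<lambda>j. a j + \<delta> k p j) z)) + (1 - cos (?c (\<lambda>j. a j - \<delta> k p j) z)) - 2 * (1 - cos (?c a z))) / 2" for k p z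
    by (simp add: distrib_right left_diff_distrib sum.distrib sum_subtractf cos_add cos_diff field_simps)
  have "(LINT z|N. ?w z * cos (?c a z)) = (LINT z|N. (\<Sum>(k, p)\<in>J \<times> {1, q}.
      ((1 - cos (?c (\<lambda>j. a j + \<delta> k p j) z)) + (1 - cos (?c (\<lambda>j. a j - \<delta> k p j) z)) - 2 * (1 - cos (?c a z))) / 2))"
    unfolding w sum_distrib_right split_beta product ..
  also have "\<dots> = (\<Sum>(k, p)\<in>J \<times> {1, q}. (I (\<lambda>j. a j + \<delta> k p j) + I (\<lambda>j. a j - \<delta> k p j) - 2 * I a) / 2)"
  proof -
    have "has_bochner_integral N (\<lambda>z. ((1 - cos (?c (\<lambda>j. a j + \<delta> k p j) z)) + (1 - cos (?c (\<lambda>j. a j - \<delta> k p j) z)) - 2 * (1 - cos (?c a z))) / 2)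
        ((I (\<lambda>j. a j + \<delta> k p j) + I (\<lambda>j. a j - \<delta> k p j) - 2 * I a) / 2)" for k p
      unfolding I_def
      by (intro has_bochner_integral_divide_zero has_bochner_integral_diff has_bochner_integral_add
          has_bochner_integral_mult_right has_bochner_integral_integrable int)
    then show ?thesis
      unfolding split_beta by (intro has_bochner_integral_integral_eq has_bochner_integral_sum) auto
  qed
  finally have cos_eq: "(LINT z|N. ?w z * cos (?c a z)) =
      (\<Sum>(k, p)\<in>J \<times> {1, q}. (I (\<lambda>j. a j + \<delta> k p j) + I (\<lambda>j. a j - \<delta> k p j) - 2 * I a) / 2)" .
  have "(LINT z|N. ?w z * sin (?c a z)) = (LINT z|distr N N \<tau>. ?w z * sin (?c a z))"
    by (simp only: \<tau>(2))
  also have "\<dots> = (LINT z|N. ?w (\<tau> z) * sin (?c a (\<tau> z)))"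
    by (rule integral_distr) measurable
  also have "\<dots> = - (LINT z|N. ?w z * sin (?c a z))"
    by (simp add: \<tau>(3) fourier_weight_def sum_negf)
  finally have sin_eq: "(LINT z|N. ?w z * sin (?c a z)) = 0" by simp
  have "(LINT z|D. exp (\<i> * complex_of_real (?c a z))) = (LINT z|N. ?w z *\<^sub>R exp (\<i> * complex_of_real (?c a z)))"
    unfolding D_def by (rule integral_density) (auto simp: fourier_weight_nonneg)
  also have "\<dots> = (LINT z|N. complex_of_real (?w z * cos (?c a z)) + \<i> * complex_of_real (?w z * sin (?c a z)))"
    by (intro Bochner_Integration.integral_cong refl) (simp only: cis_conv_exp[symmetric], simp add: complex_eq_iff)
  also have "\<dots> = complex_of_real (LINT z|N. ?w z * cos (?c a z)) + \<i> * complex_of_real (LINT z|N. ?w z * sin (?c a z))"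
    using cos_int sin_int by (simp add: integral_complex_of_real del: of_real_mult)
  finally show "(LINT z|D. exp (\<i> * complex_of_real (?c a z))) =
      complex_of_real (\<Sum>(k, p)\<in>J \<times> {1, q}. (I (\<lambda>j. a j + \<delta> k p j) + I (\<lambda>j. a j - \<delta> k p j) - 2 * I a) / 2)"
    by (simp only: cos_eq sin_eq) simp
qed

text \<open>
  On the exceedance set the weight is positive and can be divided out again.
\<close>

lemma exceedance_from_weighted_distribution:
  fixes y :: "'t \<Rightarrow> 'n \<Rightarrow> real"
  assumes J: "finite J" and q: "q \<notin> \<rat>" and [measurable]: "\<And>j. j \<in> J \<Longrightarrow> y j \<in> borel_measurable N"
    and a: "\<And>j. j \<in> J \<Longrightarrow> 0 < a j"
  defines "D \<equiv> density N (\<lambda>z. ennreal (fourier_weight q J (\<lambda>j. y j z)))"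
  shows "emeasure N {z\<in>space N. \<exists>j\<in>J. a j < \<bar>y j z\<bar>} =
    (\<integral>\<^sup>+v. (if \<exists>j\<in>J. a j < \<bar>v j\<bar> then ennreal (1 / fourier_weight q J v) else 0)
      \<partial>distr D (\<Pi>\<^sub>M j\<in>J. borel) (\<lambda>z. \<lambda>j\<in>J. y j z))"
proof -
  let ?h = "\<lambda>v. if \<exists>j\<in>J. a j < \<bar>v j\<bar> then ennreal (1 / fourier_weight q J v) else 0"
  have h_cong: "?h (\<lambda>j\<in>J. y j z) = ?h (\<lambda>j. y j z)" for z
  proof -
    have "fourier_weight q J (\<lambda>j\<in>J. y j z) = fourier_weight q J (\<lambda>j. y j z)"
      unfolding fourier_weight_def by (intro sum.cong) auto
    then show ?thesis by simp
  qed
  have [measurable]: "(\<lambda>z. fourier_weight q J (\<lambda>j. y j z)) \<in> borel_measurable N"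
    unfolding fourier_weight_def by (intro borel_measurable_sum) auto
  have [measurable]: "fourier_weight q J \<in> borel_measurable (\<Pi>\<^sub>M j\<in>J. borel)"
    unfolding fourier_weight_def by (intro borel_measurable_sum) auto
  have h[measurable]: "?h \<in> borel_measurable (\<Pi>\<^sub>M j\<in>J. borel)"
    using J by measurable
  have h': "(\<lambda>z. ?h (\<lambda>j\<in>J. y j z)) \<in> borel_measurable N"
    by (rule measurable_compose[OF _ h]) measurable
  have "(\<integral>\<^sup>+v. ?h v \<partial>distr D (\<Pi>\<^sub>M j\<in>J. borel) (\<lambda>z. \<lambda>j\<in>J. y j z)) = (\<integral>\<^sup>+z. ?h (\<lambda>j\<in>J. y j z) \<partial>D)"
    unfolding D_def by (rule nn_integral_distr) auto
  also have "\<dots> = (\<integral>\<^sup>+z. ennreal (fourier_weight q J (\<lambda>j. y j z)) * ?h (\<lambda>j\<in>J. y j z) \<partial>N)"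
    unfolding D_def by (rule nn_integral_density[OF _ h']) auto
  also have "\<dots> = (\<integral>\<^sup>+z. indicator {z\<in>space N. \<exists>j\<in>J. a j < \<bar>y j z\<bar>} z \<partial>N)"
  proof (rule nn_integral_cong)
    fix z assume z: "z \<in> space N"
    show "ennreal (fourier_weight q J (\<lambda>j. y j z)) * ?h (\<lambda>j\<in>J. y j z) = indicator {z\<in>space N. \<exists>j\<in>J. a j < \<bar>y j z\<bar>} z"
    proof (cases "\<exists>j\<in>J. a j < \<bar>y j z\<bar>")
      case True
      then obtain k where "k \<in> J" "y k z \<noteq> 0"
        using a by fastforce
      then have "0 < fourier_weight q J (\<lambda>j. y j z)"
        by (intro fourier_weight_pos J q)
      then show ?thesis
        unfolding h_cong using True z by (simp add: indicator_def flip: ennreal_mult)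
    qed (simp add: indicator_def)
  qed
  also have "\<dots> = emeasure N {z\<in>space N. \<exists>j\<in>J. a j < \<bar>y j z\<bar>}"
    using J by (intro nn_integral_indicator) measurable
  finally show ?thesis ..
qed

text \<open>
  Weighting makes both measures finite with equal characteristic functions, so the weighted joint
  laws coincide, and exceedance masses are integrals against them.
\<close>

theorem exceedances_eqI_cosines:
  fixes N1 :: "'m measure" and N2 :: "'n measure"
    and y1 :: "'t \<Rightarrow> 'm \<Rightarrow> real" and y2 :: "'t \<Rightarrow> 'n \<Rightarrow> real"
  assumes J: "finite J"
    and y: "\<And>j. j \<in> J \<Longrightarrow> y1 j \<in> borel_measurable N1" "\<And>j. j \<in> J \<Longrightarrow> y2 j \<in> borel_measurable N2"
    and \<sigma>: "\<sigma> \<in> N1 \<rightarrow>\<^sub>M N1" "distr N1 N1 \<sigma> = N1" "\<And>j z. y1 j (\<sigma> z) = - y1 j z"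
    and \<rho>: "\<rho> \<in> N2 \<rightarrow>\<^sub>M N2" "distr N2 N2 \<rho> = N2" "\<And>j z. y2 j (\<rho> z) = - y2 j z"
    and fin: "\<And>b. (\<integral>\<^sup>+z. ennreal (1 - cos (\<Sum>j\<in>J. b j * y1 j z)) \<partial>N1) < \<infinity>"
    and eq: "\<And>b. (\<integral>\<^sup>+z. ennreal (1 - cos (\<Sum>j\<in>J. b j * y1 j z)) \<partial>N1) =
      (\<integral>\<^sup>+z. ennreal (1 - cos (\<Sum>j\<in>J. b j * y2 j z)) \<partial>N2)"
    and a: "\<And>j. j \<in> J \<Longrightarrow> 0 < a j"
  shows "emeasure N1 {z\<in>space N1. \<exists>j\<in>J. a j < \<bar>y1 j z\<bar>} = emeasure N2 {z\<in>space N2. \<exists>j\<in>J. a j < \<bar>y2 j z\<bar>}"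
proof -
  have "\<exists>q::real. q \<notin> \<rat>"
    using countable_rat uncountable_UNIV_real by (metis UNIV_eq_I)
  then obtain q :: real where q: "q \<notin> \<rat>" ..
  note [measurable] = y
  have fin2: "(\<integral>\<^sup>+z. ennreal (1 - cos (\<Sum>j\<in>J. b j * y2 j z)) \<partial>N2) < \<infinity>" for b
    using fin[of b] unfolding eq .
  have I: "(LINT z|N1. 1 - cos (\<Sum>j\<in>J. b j * y1 j z)) = (LINT z|N2. 1 - cos (\<Sum>j\<in>J. b j * y2 j z))" for b
    by (subst (1 2) integral_eq_nn_integral) (auto simp: eq)
  note w1 = weighted_fourier_transform[where \<tau>=\<sigma> and q=q, OF J y(1) fin \<sigma>]
  note w2 = weighted_fourier_transform[where \<tau>=\<rho> and q=q, OF J y(2) fin2 \<rho>]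
  have "distr (density N1 (\<lambda>z. ennreal (fourier_weight q J (\<lambda>j. y1 j z)))) (\<Pi>\<^sub>M j\<in>J. borel) (\<lambda>z. \<lambda>j\<in>J. y1 j z) =
      distr (density N2 (\<lambda>z. ennreal (fourier_weight q J (\<lambda>j. y2 j z)))) (\<Pi>\<^sub>M j\<in>J. borel) (\<lambda>z. \<lambda>j\<in>J. y2 j z)"
    by (rule joint_distribution_eqI_fourier[OF J w1(1) w2(1)]) (simp_all only: w1(2) w2(2) I measurable_density_eq1 y)
  then show ?thesis
    using exceedance_from_weighted_distribution[OF J q y(1) a] exceedance_from_weighted_distribution[OF J q y(2) a]
    by simp
qed

text \<open>
  Restricted to the exceedance set of a constant level \<open>\<epsilon>\<close>, each measure is finite, and the mass
  of a box is a difference of masses of exceedance sets. So the restrictions of the law of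
  \<open>(\<bar>y j\<bar>)\<^sub>j\<close> coincide, and since \<open>1 - cos\<close> vanishes at the origin, its integral is the supremum
  of the integrals over these restrictions as \<open>\<epsilon> = 1 / Suc n\<close> decreases to \<open>0\<close>. The hypothesis
  \<open>abs\<close> says that the cosines are functions of the absolute values; without it these laws would
  not determine the integrals.
\<close>

theorem cosines_eqI_exceedances:
  fixes N1 :: "'m measure" and N2 :: "'n measure"
    and y1 :: "'t \<Rightarrow> 'm \<Rightarrow> real" and y2 :: "'t \<Rightarrow> 'n \<Rightarrow> real"
  assumes J: "finite J"
    and y: "\<And>j. j \<in> J \<Longrightarrow> y1 j \<in> borel_measurable N1" "\<And>j. j \<in> J \<Longrightarrow> y2 j \<in> borel_measurable N2"
    and abs: "\<And>z. cos (\<Sum>j\<in>J. b j * y1 j z) = cos (\<Sum>j\<in>J. b j * \<bar>y1 j z\<bar>)"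
      "\<And>z. cos (\<Sum>j\<in>J. b j * y2 j z) = cos (\<Sum>j\<in>J. b j * \<bar>y2 j z\<bar>)"
    and fin: "\<And>a. (\<And>j. j \<in> J \<Longrightarrow> 0 < a j) \<Longrightarrow> emeasure N1 {z\<in>space N1. \<exists>j\<in>J. a j < \<bar>y1 j z\<bar>} < \<infinity>"
    and eq: "\<And>a. (\<And>j. j \<in> J \<Longrightarrow> 0 < a j) \<Longrightarrow>
      emeasure N1 {z\<in>space N1. \<exists>j\<in>J. a j < \<bar>y1 j z\<bar>} = emeasure N2 {z\<in>space N2. \<exists>j\<in>J. a j < \<bar>y2 j z\<bar>}"
  shows "(\<integral>\<^sup>+z. ennreal (1 - cos (\<Sum>j\<in>J. b j * y1 j z)) \<partial>N1) =
    (\<integral>\<^sup>+z. ennreal (1 - cos (\<Sum>j\<in>J. b j * y2 j z)) \<partial>N2)"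
proof -
  let ?E1 = "\<lambda>a. {z\<in>space N1. \<exists>j\<in>J. a j < \<bar>y1 j z\<bar>}"
  let ?E2 = "\<lambda>a. {z\<in>space N2. \<exists>j\<in>J. a j < \<bar>y2 j z\<bar>}"
  let ?D1 = "\<lambda>n::nat. density N1 (indicator (?E1 (\<lambda>_. 1 / Suc n)))"
  let ?D2 = "\<lambda>n::nat. density N2 (indicator (?E2 (\<lambda>_. 1 / Suc n)))"
  have fin2: "emeasure N2 (?E2 a) < \<infinity>" if "\<And>j. j \<in> J \<Longrightarrow> 0 < a j" for a
    using fin[OF that] eq[OF that] by simp
  have set: "{z\<in>space N. \<exists>j\<in>J. a j < \<bar>y j z\<bar>} \<in> sets N"
    if [measurable]: "\<And>j. j \<in> J \<Longrightarrow> y j \<in> borel_measurable N" for N :: "'c measure" and y :: "'t \<Rightarrow> 'c \<Rightarrow> real" and a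
    using J by measurable
  have D: "finite_measure (density N (indicator {z\<in>space N. \<exists>j\<in>J. a j < \<bar>y j z\<bar>}))"
    and box: "emeasure (density N (indicator {z\<in>space N. \<exists>j\<in>J. a j < \<bar>y j z\<bar>})) {z\<in>space N. \<forall>j\<in>J. \<bar>y j z\<bar> \<le> c j} =
      emeasure N {z\<in>space N. \<exists>j\<in>J. min (a j) (c j) < \<bar>y j z\<bar>} - emeasure N {z\<in>space N. \<exists>j\<in>J. c j < \<bar>y j z\<bar>}"
    if [measurable]: "\<And>j. j \<in> J \<Longrightarrow> y j \<in> borel_measurable N"
      and f: "\<And>a. (\<And>j. j \<in> J \<Longrightarrow> 0 < a j) \<Longrightarrow> emeasure N {z\<in>space N. \<exists>j\<in>J. a j < \<bar>y j z\<bar>} < \<infinity>"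
      and pos: "\<And>j. j \<in> J \<Longrightarrow> 0 < a j" "\<And>j. j \<in> J \<Longrightarrow> 0 < c j"
    for N :: "'c measure" and y :: "'t \<Rightarrow> 'c \<Rightarrow> real" and a c
  proof -
    have E[measurable]: "{z\<in>space N. \<exists>j\<in>J. a j < \<bar>y j z\<bar>} \<in> sets N" for a
      by (rule set) measurable
    show "finite_measure (density N (indicator {z\<in>space N. \<exists>j\<in>J. a j < \<bar>y j z\<bar>}))"
      using f[of a] pos by (intro finite_measureI) (simp add: emeasure_density less_top[symmetric] nn_integral_indicator' cong: nn_integral_cong)
    have B: "{z\<in>space N. \<forall>j\<in>J. \<bar>y j z\<bar> \<le> c j} \<in> sets N"
      using J by measurable
    have "emeasure (density N (indicator {z\<in>space N. \<exists>j\<in>J. a j < \<bar>y j z\<bar>})) {z\<in>space N. \<forall>j\<in>J. \<bar>y j z\<bar> \<le> c j} =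
        emeasure N ({z\<in>space N. \<exists>j\<in>J. a j < \<bar>y j z\<bar>} \<inter> {z\<in>space N. \<forall>j\<in>J. \<bar>y j z\<bar> \<le> c j})"
      using B by (intro emeasure_restricted) auto
    \<comment> \<open>A point leaving one of two boxes leaves their intersection, whose corner is the minimum of the corners.\<close>
    also have "{z\<in>space N. \<exists>j\<in>J. a j < \<bar>y j z\<bar>} \<inter> {z\<in>space N. \<forall>j\<in>J. \<bar>y j z\<bar> \<le> c j} =
        {z\<in>space N. \<exists>j\<in>J. min (a j) (c j) < \<bar>y j z\<bar>} - {z\<in>space N. \<exists>j\<in>J. c j < \<bar>y j z\<bar>}"
      by (force simp: not_less)
    also have "emeasure N \<dots> = emeasure N {z\<in>space N. \<exists>j\<in>J. min (a j) (c j) < \<bar>y j z\<bar>} - emeasure N {z\<in>space N. \<exists>j\<in>J. c j < \<bar>y j z\<bar>}"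
      using f[of c] pos by (intro emeasure_Diff E) (auto simp: min_less_iff_disj)
    finally show "emeasure (density N (indicator {z\<in>space N. \<exists>j\<in>J. a j < \<bar>y j z\<bar>})) {z\<in>space N. \<forall>j\<in>J. \<bar>y j z\<bar> \<le> c j} =
      emeasure N {z\<in>space N. \<exists>j\<in>J. min (a j) (c j) < \<bar>y j z\<bar>} - emeasure N {z\<in>space N. \<exists>j\<in>J. c j < \<bar>y j z\<bar>}" .
  qed
  have dist: "distr (?D1 n) (\<Pi>\<^sub>M j\<in>J. borel) (\<lambda>z. \<lambda>j\<in>J. \<bar>y1 j z\<bar>) = distr (?D2 n) (\<Pi>\<^sub>M j\<in>J. borel) (\<lambda>z. \<lambda>j\<in>J. \<bar>y2 j z\<bar>)" for n
  proof (rule joint_distribution_eqI_cdf[OF J])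
    show "finite_measure (?D1 n)" "finite_measure (?D2 n)"
      using D[OF y(1) fin, of "\<lambda>_. 1 / Suc n" "\<lambda>_. 1"] D[OF y(2) fin2, of "\<lambda>_. 1 / Suc n" "\<lambda>_. 1"] by auto
    show "(\<lambda>z. \<bar>y1 j z\<bar>) \<in> borel_measurable (?D1 n)" "(\<lambda>z. \<bar>y2 j z\<bar>) \<in> borel_measurable (?D2 n)" if "j \<in> J" for j
      using y that by auto
    show "emeasure (?D1 n) {z\<in>space (?D1 n). \<forall>j\<in>J. \<bar>y1 j z\<bar> \<le> c j} = emeasure (?D2 n) {z\<in>space (?D2 n). \<forall>j\<in>J. \<bar>y2 j z\<bar> \<le> c j}"
      if c: "\<And>j. j \<in> J \<Longrightarrow> 0 < c j" for c
    proof -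
      have "emeasure N1 (?E1 (\<lambda>j. min (1 / Suc n) (c j))) = emeasure N2 (?E2 (\<lambda>j. min (1 / Suc n) (c j)))"
        by (rule eq) (simp add: c)
      then show ?thesis
        using box[OF y(1) fin _ c, of "\<lambda>_. 1 / Suc n"] box[OF y(2) fin2 _ c, of "\<lambda>_. 1 / Suc n"] eq[OF c] by simp
    qed
  qed auto
  let ?h = "\<lambda>v. ennreal (1 - cos (\<Sum>j\<in>J. b j * v j))"
  have trunc: "(\<integral>\<^sup>+z. ?h (\<lambda>j. y j z) \<partial>N) = (SUP n. \<integral>\<^sup>+v. ?h v
      \<partial>distr (density N (indicator {z\<in>space N. \<exists>j\<in>J. 1 / Suc n < \<bar>y j z\<bar>})) (\<Pi>\<^sub>M j\<in>J. borel) (\<lambda>z. \<lambda>j\<in>J. \<bar>y j z\<bar>))"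
    if [measurable]: "\<And>j. j \<in> J \<Longrightarrow> y j \<in> borel_measurable N"
      and abs: "\<And>z. cos (\<Sum>j\<in>J. b j * y j z) = cos (\<Sum>j\<in>J. b j * \<bar>y j z\<bar>)"
    for N :: "'c measure" and y :: "'t \<Rightarrow> 'c \<Rightarrow> real"
  proof -
    define E where "E n = {z\<in>space N. \<exists>j\<in>J. 1 / real (Suc n) < \<bar>y j z\<bar>}" for n
    have E[measurable]: "E n \<in> sets N" for n
      unfolding E_def by (rule set) measurable
    have inc: "E m \<subseteq> E n" if "m \<le> n" for m n
    proof -
      have "1 / real (Suc n) \<le> 1 / real (Suc m)"
        using that by (intro divide_left_mono) auto
      then show ?thesis unfolding E_def by (auto intro: le_less_trans)
    qed
    have "(\<integral>\<^sup>+z. ?h (\<lambda>j. y j z) \<partial>N) = (\<integral>\<^sup>+z. (SUP n. indicator (E n) z * ?h (\<lambda>j. y j z)) \<partial>N)"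
    proof (rule nn_integral_cong)
      fix z assume z: "z \<in> space N"
      show "?h (\<lambda>j. y j z) = (SUP n. indicator (E n) z * ?h (\<lambda>j. y j z))"
      proof (cases "\<exists>j\<in>J. y j z \<noteq> 0")
        case True
        then obtain k where k: "k \<in> J" "0 < \<bar>y k z\<bar>" by auto
        obtain n where "1 / real (Suc n) < \<bar>y k z\<bar>"
          using nat_approx_posE[OF k(2)] by blast
        then have "z \<in> E n" using k z by (auto simp: E_def)
        then have "?h (\<lambda>j. y j z) \<le> (SUP n. indicator (E n) z * ?h (\<lambda>j. y j z))"
          by (intro SUP_upper2[of n]) auto
        moreover have "(SUP n. indicator (E n) z * ?h (\<lambda>j. y j z)) \<le> ?h (\<lambda>j. y j z)"
          by (intro SUP_least) (simp add: indicator_def)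
        ultimately show ?thesis by (rule antisym)
      qed simp
    qed
    also have "\<dots> = (SUP n. \<integral>\<^sup>+z. indicator (E n) z * ?h (\<lambda>j. y j z) \<partial>N)"
      by (rule nn_integral_monotone_convergence_SUP)
        (auto simp: incseq_def le_fun_def indicator_def intro: subsetD[OF inc])
    also have "\<dots> = (SUP n. \<integral>\<^sup>+v. ?h v \<partial>distr (density N (indicator (E n))) (\<Pi>\<^sub>M j\<in>J. borel) (\<lambda>z. \<lambda>j\<in>J. \<bar>y j z\<bar>))"
    proof (intro SUP_cong refl)
      fix n
      have "(\<integral>\<^sup>+v. ?h v \<partial>distr (density N (indicator (E n))) (\<Pi>\<^sub>M j\<in>J. borel) (\<lambda>z. \<lambda>j\<in>J. \<bar>y j z\<bar>)) =
          (\<integral>\<^sup>+z. ?h (\<lambda>j\<in>J. \<bar>y j z\<bar>) \<partial>density N (indicator (E n)))"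
        by (rule nn_integral_distr) auto
      also have "\<dots> = (\<integral>\<^sup>+z. indicator (E n) z * ?h (\<lambda>j\<in>J. \<bar>y j z\<bar>) \<partial>N)"
        by (rule nn_integral_density) auto
      also have "\<dots> = (\<integral>\<^sup>+z. indicator (E n) z * ?h (\<lambda>j. y j z) \<partial>N)"
        by (simp add: abs cong: sum.cong)
      finally show "(\<integral>\<^sup>+z. indicator (E n) z * ?h (\<lambda>j. y j z) \<partial>N) = (\<integral>\<^sup>+v. ?h v \<partial>distr (density N (indicator (E n))) (\<Pi>\<^sub>M j\<in>J. borel) (\<lambda>z. \<lambda>j\<in>J. \<bar>y j z\<bar>))" ..
    qed
    finally show ?thesis unfolding E_def .
  qed
  show ?thesis
    using trunc[OF y(1) abs(1)] trunc[OF y(2) abs(2)] by (simp only: dist)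
qed

section \<open>Stable and Frechet exponents\<close>

lemma restrict_family_in_L_space_nonneg:
  assumes \<alpha>: "0 < \<alpha>" and f: "f t \<in> L_space_nonneg \<alpha> M" and A: "A \<in> sets M"
  shows "restrict_family A f t \<in> L_space_nonneg \<alpha> M"
proof -
  have [measurable]: "f t \<in> borel_measurable M" and int: "integrable M (\<lambda>x. \<bar>f t x\<bar> powr \<alpha>)"
    and nonneg: "AE x in M. 0 \<le> f t x"
    using f by (auto simp: L_space_nonneg_def L_space_def)
  note [measurable] = A
  have "integrable M (\<lambda>x. \<bar>f t x * indicator A x\<bar> powr \<alpha>)"
    by (rule Bochner_Integration.integrable_bound[OF int]) (auto simp: indicator_def)
  then show ?thesis
    using nonneg by (auto simp: L_space_nonneg_def L_space_def restrict_family_def indicator_def)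
qed

text \<open>
  The dominating index may depend on the point, so the bound \<open>C j powr \<alpha> * \<bar>g j\<bar> powr \<alpha>\<close> is summed
  over \<open>j\<close>. This avoids quasi-norm inequalities and works equally for sums and for maxima.
\<close>

lemma integrable_powr_of_L_space:
  fixes g :: "'t \<Rightarrow> 'a \<Rightarrow> real"
  assumes \<alpha>: "0 < \<alpha>" and J: "finite J" "J \<noteq> {}" and g: "\<And>j. j \<in> J \<Longrightarrow> g j \<in> L_space \<alpha> M"
    and [measurable]: "F \<in> borel_measurable M"
    and dom: "\<And>x. \<exists>j\<in>J. \<bar>F x\<bar> \<le> C j * \<bar>g j x\<bar>" and C: "\<And>j. 0 \<le> C j"
  shows "integrable M (\<lambda>x. \<bar>F x\<bar> powr \<alpha>)"
proof (rule Bochner_Integration.integrable_bound)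
  show "integrable M (\<lambda>x. \<Sum>j\<in>J. C j powr \<alpha> * \<bar>g j x\<bar> powr \<alpha>)"
    using g by (intro Bochner_Integration.integrable_sum integrable_mult_right) (auto simp: L_space_def)
  have "\<bar>F x\<bar> powr \<alpha> \<le> (\<Sum>j\<in>J. C j powr \<alpha> * \<bar>g j x\<bar> powr \<alpha>)" for x
  proof -
    obtain k where k: "k \<in> J" "\<bar>F x\<bar> \<le> C k * \<bar>g k x\<bar>" using dom by blast
    have "\<bar>F x\<bar> powr \<alpha> \<le> (C k * \<bar>g k x\<bar>) powr \<alpha>"
      using k \<alpha> by (intro powr_mono2) auto
    also have "\<dots> = C k powr \<alpha> * \<bar>g k x\<bar> powr \<alpha>"
      using C by (intro powr_mult)
    also have "\<dots> \<le> (\<Sum>j\<in>J. C j powr \<alpha> * \<bar>g j x\<bar> powr \<alpha>)"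
      using J k by (intro member_le_sum) auto
    finally show ?thesis .
  qed
  then show "AE x in M. norm (\<bar>F x\<bar> powr \<alpha>) \<le> norm (\<Sum>j\<in>J. C j powr \<alpha> * \<bar>g j x\<bar> powr \<alpha>)"
    by (intro AE_I2) (simp add: abs_of_nonneg sum_nonneg)
qed simp

lemma integrable_stable_exponent:
  fixes g :: "'t \<Rightarrow> 'a \<Rightarrow> real"
  assumes \<alpha>: "0 < \<alpha>" and J: "finite J" "J \<noteq> {}" and g: "\<And>j. j \<in> J \<Longrightarrow> g j \<in> L_space \<alpha> M"
  shows "integrable M (\<lambda>x. \<bar>\<Sum>j\<in>J. b j * g j x\<bar> powr \<alpha>)"
proof (rule integrable_powr_of_L_space[OF \<alpha> J g, where C="\<lambda>j. real (card J) * \<bar>b j\<bar>"])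
  show "(\<lambda>x. \<Sum>j\<in>J. b j * g j x) \<in> borel_measurable M"
    using g by (intro borel_measurable_sum borel_measurable_times) (auto simp: L_space_def)
  fix x
  obtain k where k: "k \<in> J" "(MAX j\<in>J. \<bar>b j * g j x\<bar>) = \<bar>b k * g k x\<bar>"
    using Max_in[of "(\<lambda>j. \<bar>b j * g j x\<bar>) ` J"] J by (auto simp del: Max_in)
  have "\<bar>\<Sum>j\<in>J. b j * g j x\<bar> \<le> (\<Sum>j\<in>J. \<bar>b j * g j x\<bar>)"
    by (rule sum_abs)
  also have "\<dots> \<le> real (card J) * \<bar>b k * g k x\<bar>"
    using J unfolding k(2)[symmetric] by (intro sum_bounded_above Max_ge) auto
  finally show "\<exists>j\<in>J. \<bar>\<Sum>j\<in>J. b j * g j x\<bar> \<le> real (card J) * \<bar>b j\<bar> * \<bar>g j x\<bar>"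
    using k(1) by (auto simp: abs_mult mult.assoc)
qed auto

lemma integrable_frechet_exponent:
  fixes g :: "'t \<Rightarrow> 'a \<Rightarrow> real"
  assumes \<alpha>: "0 < \<alpha>" and J: "finite J" "J \<noteq> {}" and g: "\<And>j. j \<in> J \<Longrightarrow> g j \<in> L_space \<alpha> M"
  shows "integrable M (\<lambda>x. \<bar>MAX j\<in>J. g j x / a j\<bar> powr \<alpha>)"
proof (rule integrable_powr_of_L_space[OF \<alpha> J g, where C="\<lambda>j. 1 / \<bar>a j\<bar>"])
  show "(\<lambda>x. MAX j\<in>J. g j x / a j) \<in> borel_measurable M"
    using J g by (intro borel_measurable_Max borel_measurable_divide) (auto simp: L_space_def)
  fix x
  obtain k where k: "k \<in> J" "(MAX j\<in>J. g j x / a j) = g k x / a k"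
    using Max_in[of "(\<lambda>j. g j x / a j) ` J"] J by (auto simp del: Max_in)
  then show "\<exists>j\<in>J. \<bar>MAX j\<in>J. g j x / a j\<bar> \<le> 1 / \<bar>a j\<bar> * \<bar>g j x\<bar>"
    by (intro bexI[of _ k]) (auto simp: abs_divide)
qed auto

text \<open>
  The spectral functions are nonnegative only almost everywhere; taking the positive part makes the
  sign relations between coordinates hold at every point without changing any exponent.
\<close>

definition levy_coordinate :: "('t \<Rightarrow> 'a \<Rightarrow> real) \<Rightarrow> 't \<Rightarrow> 'a \<times> real \<Rightarrow> real" where
  "levy_coordinate g j z = snd z * max 0 (g j (fst z))"

lemma levy_coordinate_measurable:
  assumes [measurable]: "g j \<in> borel_measurable M"
  shows "levy_coordinate g j \<in> borel_measurable (levy_measure \<alpha> M)"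
  unfolding levy_coordinate_def by measurable

lemma stable_exponent_levy:
  fixes g :: "'t \<Rightarrow> 'a \<Rightarrow> real"
  assumes \<alpha>: "0 < \<alpha>" and J: "finite J" "J \<noteq> {}" and g: "\<And>j. j \<in> J \<Longrightarrow> g j \<in> L_space_nonneg \<alpha> M"
  shows "(\<integral>\<^sup>+z. ennreal (1 - cos (\<Sum>j\<in>J. b j * levy_coordinate g j z)) \<partial>levy_measure \<alpha> M) =
    stable_constant \<alpha> * ennreal (LINT x|M. \<bar>\<Sum>j\<in>J. b j * g j x\<bar> powr \<alpha>)"
proof -
  have [measurable]: "g j \<in> borel_measurable M" if "j \<in> J" for j
    using g[OF that] by (simp add: L_space_nonneg_def L_space_def)
  have "AE x in M. \<forall>j\<in>J. 0 \<le> g j x"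
    using g J by (intro AE_finite_allI) (auto simp: L_space_nonneg_def)
  then have "(\<integral>\<^sup>+x. ennreal (\<bar>\<Sum>j\<in>J. b j * max 0 (g j x)\<bar> powr \<alpha>) \<partial>M) =
      (\<integral>\<^sup>+x. ennreal (\<bar>\<Sum>j\<in>J. b j * g j x\<bar> powr \<alpha>) \<partial>M)"
    by (intro nn_integral_cong_AE, elim eventually_mono) (simp add: max_absorb2 cong: sum.cong)
  also have "\<dots> = ennreal (LINT x|M. \<bar>\<Sum>j\<in>J. b j * g j x\<bar> powr \<alpha>)"
    using g by (intro nn_integral_eq_integral integrable_stable_exponent \<alpha> J) (auto simp: L_space_nonneg_def)
  finally show ?thesis
    unfolding levy_coordinate_def by (subst levy_measure_one_minus_cos) auto
qed

lemma frechet_exponent_levy: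
  fixes g :: "'t \<Rightarrow> 'a \<Rightarrow> real"
  assumes \<alpha>: "0 < \<alpha>" and J: "finite J" "J \<noteq> {}" and g: "\<And>j. j \<in> J \<Longrightarrow> g j \<in> L_space_nonneg \<alpha> M"
    and a: "\<And>j. j \<in> J \<Longrightarrow> 0 < a j"
  shows "emeasure (levy_measure \<alpha> M) {z\<in>space (levy_measure \<alpha> M). \<exists>j\<in>J. a j < \<bar>levy_coordinate g j z\<bar>} =
    frechet_constant \<alpha> * ennreal (LINT x|M. (MAX j\<in>J. g j x / a j) powr \<alpha>)"
proof -
  have [measurable]: "g j \<in> borel_measurable M" if "j \<in> J" for j
    using g[OF that] by (simp add: L_space_nonneg_def L_space_def)
  have [measurable]: "(\<lambda>x. MAX j\<in>J. g j x / a j) \<in> borel_measurable M"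
    using J by (intro borel_measurable_Max) auto
  have nonneg: "AE x in M. \<forall>j\<in>J. 0 \<le> g j x"
    using g J by (intro AE_finite_allI) (auto simp: L_space_nonneg_def)
  have abs: "AE x in M. \<bar>MAX j\<in>J. g j x / a j\<bar> powr \<alpha> = (MAX j\<in>J. g j x / a j) powr \<alpha>"
    using nonneg by eventually_elim (use Max_nonneg_image[OF J] a in \<open>simp add: less_imp_le\<close>)
  have "integrable M (\<lambda>x. \<bar>MAX j\<in>J. g j x / a j\<bar> powr \<alpha>)"
    using g by (intro integrable_frechet_exponent \<alpha> J) (auto simp: L_space_nonneg_def)
  then have int: "integrable M (\<lambda>x. (MAX j\<in>J. g j x / a j) powr \<alpha>)"
    using abs by (subst (asm) integrable_cong_AE) auto
  have "(\<integral>\<^sup>+x. ennreal ((MAX j\<in>J. max 0 (g j x) / a j) powr \<alpha>) \<partial>M) =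
      (\<integral>\<^sup>+x. ennreal ((MAX j\<in>J. g j x / a j) powr \<alpha>) \<partial>M)"
    using nonneg by (intro nn_integral_cong_AE, elim eventually_mono) (simp add: max_absorb2 cong: image_cong)
  also have "\<dots> = ennreal (LINT x|M. (MAX j\<in>J. g j x / a j) powr \<alpha>)"
    by (intro nn_integral_eq_integral int) auto
  finally show ?thesis
    unfolding levy_coordinate_def using J a by (subst levy_measure_exceedance) auto
qed

text \<open>
  Both exponents are functionals of the same measure, integrals of \<open>1 - cos\<close> and masses of
  exceedance sets, and either kind of functional determines the other. Nonnegativity enters through
  \<open>cos_abs\<close>: all coordinates of a point carry the sign of \<open>r\<close>, so the cosine of a linear
  combination is unchanged when each coordinate is replaced by its absolute value.
\<close>

theorem stable_exponents_eq_iff_frechet_exponents_eq: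
  fixes g1 :: "'t \<Rightarrow> 'a \<Rightarrow> real" and g2 :: "'t \<Rightarrow> 'b \<Rightarrow> real"
  assumes \<alpha>: "0 < \<alpha>" "\<alpha> < 2" and J: "finite J" "J \<noteq> {}"
    and g: "\<And>j. j \<in> J \<Longrightarrow> g1 j \<in> L_space_nonneg \<alpha> M1" "\<And>j. j \<in> J \<Longrightarrow> g2 j \<in> L_space_nonneg \<alpha> M2"
  shows "(\<forall>b. (LINT x|M1. \<bar>\<Sum>j\<in>J. b j * g1 j x\<bar> powr \<alpha>) = (LINT x|M2. \<bar>\<Sum>j\<in>J. b j * g2 j x\<bar> powr \<alpha>)) \<longleftrightarrow>
    (\<forall>a. (\<forall>j\<in>J. 0 < a j) \<longrightarrow>
      (LINT x|M1. (MAX j\<in>J. g1 j x / a j) powr \<alpha>) = (LINT x|M2. (MAX j\<in>J. g2 j x / a j) powr \<alpha>))"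
    (is "(\<forall>b. ?S1 b = ?S2 b) \<longleftrightarrow> (\<forall>a. _ a \<longrightarrow> ?F1 a = ?F2 a)")
proof -
  let ?N1 = "levy_measure \<alpha> M1" and ?N2 = "levy_measure \<alpha> M2"
  let ?y1 = "levy_coordinate g1" and ?y2 = "levy_coordinate g2"
  note S1 = stable_exponent_levy[of \<alpha> J g1 M1, OF \<alpha>(1) J g(1)]
  note S2 = stable_exponent_levy[of \<alpha> J g2 M2, OF \<alpha>(1) J g(2)]
  note F1 = frechet_exponent_levy[of \<alpha> J g1 M1, OF \<alpha>(1) J g(1)]
  note F2 = frechet_exponent_levy[of \<alpha> J g2 M2, OF \<alpha>(1) J g(2)]
  note K = stable_constant[OF \<alpha>] and L = frechet_constant[OF \<alpha>]
  have cancel: "x = y" if "c * ennreal x = c * ennreal y" "c < \<infinity>" "0 < c" "0 \<le> x" "0 \<le> y" for c x y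
    using that by (auto simp: ennreal_mult_cancel_left less_top[symmetric])
  have y: "j \<in> J \<Longrightarrow> ?y1 j \<in> borel_measurable ?N1" "j \<in> J \<Longrightarrow> ?y2 j \<in> borel_measurable ?N2" for j
    using g by (auto intro!: levy_coordinate_measurable simp: L_space_nonneg_def L_space_def)
  show ?thesis
  proof (intro iffI allI impI)
    fix a :: "'t \<Rightarrow> real" assume eq: "\<forall>b. ?S1 b = ?S2 b" and a: "\<forall>j\<in>J. 0 < a j"
    have "emeasure ?N1 {z\<in>space ?N1. \<exists>j\<in>J. a j < \<bar>?y1 j z\<bar>} = emeasure ?N2 {z\<in>space ?N2. \<exists>j\<in>J. a j < \<bar>?y2 j z\<bar>}"
    proof (rule exceedances_eqI_cosines[OF J(1) y, where \<sigma>="\<lambda>z. (fst z, - snd z)" and \<rho>="\<lambda>z. (fst z, - snd z)"])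
      show "(\<integral>\<^sup>+z. ennreal (1 - cos (\<Sum>j\<in>J. b j * ?y1 j z)) \<partial>?N1) < \<infinity>" for b
        using S1[of b] K by (simp add: ennreal_mult_less_top)
      show "(\<integral>\<^sup>+z. ennreal (1 - cos (\<Sum>j\<in>J. b j * ?y1 j z)) \<partial>?N1) =
          (\<integral>\<^sup>+z. ennreal (1 - cos (\<Sum>j\<in>J. b j * ?y2 j z)) \<partial>?N2)" for b
        using S1[of b] S2[of b] eq by simp
    qed (use a in \<open>auto simp: levy_measure_reflection levy_coordinate_def\<close>)
    then show "?F1 a = ?F2 a"
      using F1[of a] F2[of a] a L by (intro cancel[of "frechet_constant \<alpha>"]) auto
  next
    fix b :: "'t \<Rightarrow> real" assume eq: "\<forall>a. (\<forall>j\<in>J. 0 < a j) \<longrightarrow> ?F1 a = ?F2 a"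
    \<comment> \<open>The sign of \<open>snd z\<close> is common to all coordinates, and the cosine is even.\<close>
    have cos_abs: "cos (\<Sum>j\<in>J. b j * levy_coordinate g j z) = cos (\<Sum>j\<in>J. b j * \<bar>levy_coordinate g j z\<bar>)"
      for g :: "'t \<Rightarrow> 'c \<Rightarrow> real" and z
    proof (cases "0 \<le> snd z")
      case False
      then have "\<bar>levy_coordinate g j z\<bar> = - levy_coordinate g j z" for j
        by (simp add: levy_coordinate_def mult_nonpos_nonneg)
      then show ?thesis by (simp add: sum_negf)
    qed (simp add: levy_coordinate_def)
    have "(\<integral>\<^sup>+z. ennreal (1 - cos (\<Sum>j\<in>J. b j * ?y1 j z)) \<partial>?N1) = (\<integral>\<^sup>+z. ennreal (1 - cos (\<Sum>j\<in>J. b j * ?y2 j z)) \<partial>?N2)"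
    proof (rule cosines_eqI_exceedances[OF J(1) y cos_abs cos_abs])
      fix a assume a: "\<And>j. j \<in> J \<Longrightarrow> (0::real) < a j"
      show "emeasure ?N1 {z\<in>space ?N1. \<exists>j\<in>J. a j < \<bar>?y1 j z\<bar>} < \<infinity>"
        using F1[of a] a L by (simp add: ennreal_mult_less_top)
      show "emeasure ?N1 {z\<in>space ?N1. \<exists>j\<in>J. a j < \<bar>?y1 j z\<bar>} = emeasure ?N2 {z\<in>space ?N2. \<exists>j\<in>J. a j < \<bar>?y2 j z\<bar>}"
        using F1[of a] F2[of a] a eq by simp
    qed
    then show "?S1 b = ?S2 b"
      using S1[of b] S2[of b] K by (intro cancel[of "stable_constant \<alpha>"]) auto
  qed
qed

section \<open>Finite-dimensional distributions and exponents\<close>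

lemma stable_integrals_fourier:
  assumes Z: "stable_integrals \<alpha> M T f P Z" and J: "finite J" "J \<noteq> {}" "J \<subseteq> T"
  shows "(LINT w|P. exp (- (\<i> * complex_of_real (\<Sum>j\<in>J. a j * Z j w)))) =
    complex_of_real (exp (- (LINT x|M. \<bar>\<Sum>j\<in>J. a j * f j x\<bar> powr \<alpha>)))"
proof -
  obtain t where t: "bij_betw t {..<card J} J"
    using ex_bij_betw_nat_finite[OF J(1)] by (auto simp: atLeast0LessThan)
  have card: "1 \<le> card J"
    using J by (simp add: Suc_le_eq card_gt_0_iff)
  have t': "\<forall>i<card J. t i \<in> T"
    using bij_betwE[OF t] J by auto
  have "(LINT w|P. exp (- (\<i> * complex_of_real (\<Sum>i<card J. a (t i) * Z (t i) w)))) =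
      complex_of_real (exp (- (LINT x|M. \<bar>\<Sum>i<card J. a (t i) * f (t i) x\<bar> powr \<alpha>)))"
    by (rule Z[unfolded stable_integrals_def, THEN conjunct2, rule_format, where a="\<lambda>i. a (t i)"]) (use card t' in auto)
  then show ?thesis
    unfolding sum.reindex_bij_betw[OF t, of "\<lambda>j. a j * Z j _"] sum.reindex_bij_betw[OF t, of "\<lambda>j. a j * f j _"] .
qed

lemma extremal_integrals_cdf:
  assumes W: "extremal_integrals \<alpha> M T f P W" and J: "finite J" "J \<noteq> {}" "J \<subseteq> T"
    and a: "\<forall>j\<in>J. 0 < a j"
  shows "measure P {w\<in>space P. \<forall>j\<in>J. W j w \<le> a j} =
    exp (- (LINT x|M. (MAX j\<in>J. f j x / a j) powr \<alpha>))"
proof -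
  obtain t where t: "bij_betw t {..<card J} J"
    using ex_bij_betw_nat_finite[OF J(1)] by (auto simp: atLeast0LessThan)
  have img: "t ` {..<card J} = J"
    using t by (simp add: bij_betw_def)
  have card: "1 \<le> card J"
    using J by (simp add: Suc_le_eq card_gt_0_iff)
  have t': "\<forall>i<card J. t i \<in> T \<and> 0 < a (t i)"
    using bij_betwE[OF t] J a by auto
  have "measure P {w\<in>space P. \<forall>i<card J. W (t i) w \<le> a (t i)} =
      exp (- (LINT x|M. (MAX i\<in>{..<card J}. f (t i) x / a (t i)) powr \<alpha>))"
    by (rule W[unfolded extremal_integrals_def, THEN conjunct2, rule_format, where a="\<lambda>i. a (t i)"]) (use card t' in auto)
  moreover have "(\<lambda>i. f (t i) x / a (t i)) ` {..<card J} = (\<lambda>j. f j x / a j) ` J" for x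
    using image_image[of "\<lambda>j. f j x / a j" t "{..<card J}"] unfolding img ..
  moreover have "(\<forall>i<card J. W (t i) w \<le> a (t i)) \<longleftrightarrow> (\<forall>j\<in>J. W j w \<le> a j)" for w
  proof -
    have "(\<forall>i<card J. W (t i) w \<le> a (t i)) \<longleftrightarrow> (\<forall>j\<in>t ` {..<card J}. W j w \<le> a j)" by auto
    then show ?thesis unfolding img .
  qed
  ultimately show ?thesis by simp
qed

lemma extremal_integrals_nonneg:
  assumes W: "extremal_integrals \<alpha> M T f P W" and t: "t \<in> T"
  shows "AE w in P. 0 \<le> W t w"
proof -
  have "frechet_process \<alpha> P T W"
    using W by (simp add: extremal_integrals_def)
  then have "frechet_rv \<alpha> P (\<lambda>w. MAX j\<in>{..<1::nat}. 1 * W t w)"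
    unfolding frechet_process_def using t by (elim conjE) (drule spec[of _ 1], drule mp, simp,
      drule spec[of _ "\<lambda>_. t"], drule spec[of _ "\<lambda>_. 1"], simp)
  then show ?thesis
    by (simp add: frechet_rv_def lessThan_Suc)
qed

lemma stable_integrals_eq_fdd_iff:
  fixes T :: "'t set"
  assumes Z1: "stable_integrals \<alpha> M1 T g1 P1 Z1" and Z2: "stable_integrals \<alpha> M2 T g2 P2 Z2"
  shows "eq_fdd T P1 Z1 P2 Z2 \<longleftrightarrow> (\<forall>J. finite J \<and> J \<noteq> {} \<and> J \<subseteq> T \<longrightarrow>
    (\<forall>b. (LINT x|M1. \<bar>\<Sum>j\<in>J. b j * g1 j x\<bar> powr \<alpha>) = (LINT x|M2. \<bar>\<Sum>j\<in>J. b j * g2 j x\<bar> powr \<alpha>)))"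
    (is "_ \<longleftrightarrow> ?exponents")
proof -
  have "process P1 T Z1" "process P2 T Z2"
    using assms by (auto simp: stable_integrals_def sas_process_def)
  then have ps: "prob_space P1" "prob_space P2"
    and [measurable]: "\<And>t. t \<in> T \<Longrightarrow> Z1 t \<in> borel_measurable P1" "\<And>t. t \<in> T \<Longrightarrow> Z2 t \<in> borel_measurable P2"
    by (auto simp: process_def)
  interpret P1: prob_space P1 by fact
  interpret P2: prob_space P2 by fact
  show ?thesis
  proof (intro iffI allI impI; (elim conjE)?)
    fix J and b :: "'t \<Rightarrow> real" assume eq: "eq_fdd T P1 Z1 P2 Z2" and J: "finite J" "J \<noteq> {}" "J \<subseteq> T"
    let ?F = "\<lambda>v. exp (- (\<i> * complex_of_real (\<Sum>j\<in>J. b j * v j)))"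
    have conv: "(LINT v|distr P (\<Pi>\<^sub>M j\<in>J. borel) (\<lambda>w. \<lambda>j\<in>J. Z j w). ?F v) = (LINT w|P. ?F (\<lambda>j. Z j w))"
      if [measurable]: "\<And>t. t \<in> T \<Longrightarrow> Z t \<in> borel_measurable P" for P :: "'p measure" and Z
    proof -
      have [measurable]: "\<And>t. t \<in> J \<Longrightarrow> Z t \<in> borel_measurable P"
        using J that by auto
      have "(LINT v|distr P (\<Pi>\<^sub>M j\<in>J. borel) (\<lambda>w. \<lambda>j\<in>J. Z j w). ?F v) = (LINT w|P. ?F (\<lambda>j\<in>J. Z j w))"
        by (rule integral_distr) measurable
      then show ?thesis by (simp cong: sum.cong)
    qed
    have "distr P1 (\<Pi>\<^sub>M t\<in>J. borel) (\<lambda>w. \<lambda>t\<in>J. Z1 t w) = distr P2 (\<Pi>\<^sub>M t\<in>J. borel) (\<lambda>w. \<lambda>t\<in>J. Z2 t w)"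
      using eq J by (simp add: eq_fdd_def)
    then have "(LINT w|P1. ?F (\<lambda>j. Z1 j w)) = (LINT w|P2. ?F (\<lambda>j. Z2 j w))"
      using conv[of Z1 P1] conv[of Z2 P2] by simp
    then show "(LINT x|M1. \<bar>\<Sum>j\<in>J. b j * g1 j x\<bar> powr \<alpha>) = (LINT x|M2. \<bar>\<Sum>j\<in>J. b j * g2 j x\<bar> powr \<alpha>)"
      unfolding stable_integrals_fourier[OF Z1 J] stable_integrals_fourier[OF Z2 J] of_real_eq_iff by simp
  next
    assume eq: ?exponents
    show "eq_fdd T P1 Z1 P2 Z2"
      unfolding eq_fdd_def
    proof (intro allI impI; elim conjE)
      fix J assume J: "finite J" "J \<subseteq> T"
      show "distr P1 (\<Pi>\<^sub>M t\<in>J. borel) (\<lambda>w. \<lambda>t\<in>J. Z1 t w) = distr P2 (\<Pi>\<^sub>M t\<in>J. borel) (\<lambda>w. \<lambda>t\<in>J. Z2 t w)"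
      proof (rule joint_distribution_eqI_fourier[OF J(1)])
        fix a :: "'t \<Rightarrow> real"
        show "(LINT w|P1. exp (\<i> * complex_of_real (\<Sum>j\<in>J. a j * Z1 j w))) =
            (LINT w|P2. exp (\<i> * complex_of_real (\<Sum>j\<in>J. a j * Z2 j w)))"
        proof (cases "J = {}")
          case False
          \<comment> \<open>The defining transform of a stable process carries a minus sign, so coefficients are negated.\<close>
          have "(LINT x|M1. \<bar>\<Sum>j\<in>J. - a j * g1 j x\<bar> powr \<alpha>) = (LINT x|M2. \<bar>\<Sum>j\<in>J. - a j * g2 j x\<bar> powr \<alpha>)"
            by (rule eq[rule_format, where b="\<lambda>j. - a j"]) (use J False in auto)
          then show ?thesis
            using stable_integrals_fourier[OF Z1 J(1) False J(2), of "\<lambda>j. - a j"]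
              stable_integrals_fourier[OF Z2 J(1) False J(2), of "\<lambda>j. - a j"]
            by (simp add: sum_negf)
        qed (simp add: P1.prob_space P2.prob_space)
      qed (use J in \<open>auto intro: P1.finite_measure_axioms P2.finite_measure_axioms\<close>)
    qed
  qed
qed

lemma extremal_integrals_eq_fdd_iff:
  fixes T :: "'t set"
  assumes W1: "extremal_integrals \<alpha> M1 T g1 P1 W1" and W2: "extremal_integrals \<alpha> M2 T g2 P2 W2"
  shows "eq_fdd T P1 W1 P2 W2 \<longleftrightarrow> (\<forall>J. finite J \<and> J \<noteq> {} \<and> J \<subseteq> T \<longrightarrow> (\<forall>a. (\<forall>j\<in>J. 0 < a j) \<longrightarrow>
    (LINT x|M1. (MAX j\<in>J. g1 j x / a j) powr \<alpha>) = (LINT x|M2. (MAX j\<in>J. g2 j x / a j) powr \<alpha>)))"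
    (is "_ \<longleftrightarrow> ?exponents")
proof -
  have "process P1 T W1" "process P2 T W2"
    using assms by (auto simp: extremal_integrals_def frechet_process_def)
  then have ps: "prob_space P1" "prob_space P2"
    and [measurable]: "\<And>t. t \<in> T \<Longrightarrow> W1 t \<in> borel_measurable P1" "\<And>t. t \<in> T \<Longrightarrow> W2 t \<in> borel_measurable P2"
    by (auto simp: process_def)
  interpret P1: prob_space P1 by fact
  interpret P2: prob_space P2 by fact
  show ?thesis
  proof (intro iffI allI impI; (elim conjE)?)
    fix J and a :: "'t \<Rightarrow> real" assume eq: "eq_fdd T P1 W1 P2 W2" and J: "finite J" "J \<noteq> {}" "J \<subseteq> T" and a: "\<forall>j\<in>J. 0 < a j"
    have conv: "measure (distr P (\<Pi>\<^sub>M j\<in>J. borel) (\<lambda>w. \<lambda>j\<in>J. W j w)) (\<Pi>\<^sub>E j\<in>J. {..a j}) =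
        measure P {w\<in>space P. \<forall>j\<in>J. W j w \<le> a j}"
      if "\<And>t. t \<in> T \<Longrightarrow> W t \<in> borel_measurable P" for P :: "'p measure" and W
    proof -
      have [measurable]: "\<And>t. t \<in> J \<Longrightarrow> W t \<in> borel_measurable P"
        using J that by auto
      have "measure (distr P (\<Pi>\<^sub>M j\<in>J. borel) (\<lambda>w. \<lambda>j\<in>J. W j w)) (\<Pi>\<^sub>E j\<in>J. {..a j}) =
          measure P ((\<lambda>w. \<lambda>j\<in>J. W j w) -` (\<Pi>\<^sub>E j\<in>J. {..a j}) \<inter> space P)"
        using J by (intro measure_distr sets_PiM_I_finite) auto
      also have "(\<lambda>w. \<lambda>j\<in>J. W j w) -` (\<Pi>\<^sub>E j\<in>J. {..a j}) \<inter> space P = {w\<in>space P. \<forall>j\<in>J. W j w \<le> a j}"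
        by (auto simp: PiE_iff)
      finally show ?thesis .
    qed
    have "distr P1 (\<Pi>\<^sub>M t\<in>J. borel) (\<lambda>w. \<lambda>t\<in>J. W1 t w) = distr P2 (\<Pi>\<^sub>M t\<in>J. borel) (\<lambda>w. \<lambda>t\<in>J. W2 t w)"
      using eq J by (simp add: eq_fdd_def)
    then have "measure P1 {w\<in>space P1. \<forall>j\<in>J. W1 j w \<le> a j} = measure P2 {w\<in>space P2. \<forall>j\<in>J. W2 j w \<le> a j}"
      using conv[of W1 P1] conv[of W2 P2] by simp
    then show "(LINT x|M1. (MAX j\<in>J. g1 j x / a j) powr \<alpha>) = (LINT x|M2. (MAX j\<in>J. g2 j x / a j) powr \<alpha>)"
      unfolding extremal_integrals_cdf[OF W1 J a] extremal_integrals_cdf[OF W2 J a] by simp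
  next
    assume eq: ?exponents
    show "eq_fdd T P1 W1 P2 W2"
      unfolding eq_fdd_def
    proof (intro allI impI; elim conjE)
      fix J assume J: "finite J" "J \<subseteq> T"
      show "distr P1 (\<Pi>\<^sub>M t\<in>J. borel) (\<lambda>w. \<lambda>t\<in>J. W1 t w) = distr P2 (\<Pi>\<^sub>M t\<in>J. borel) (\<lambda>w. \<lambda>t\<in>J. W2 t w)"
      proof (rule joint_distribution_eqI_cdf[OF J(1)])
        fix a :: "'t \<Rightarrow> real" assume "\<And>j. j \<in> J \<Longrightarrow> (0::real) < a j"
        then have a: "\<forall>j\<in>J. 0 < a j" by simp
        show "emeasure P1 {w\<in>space P1. \<forall>j\<in>J. W1 j w \<le> a j} = emeasure P2 {w\<in>space P2. \<forall>j\<in>J. W2 j w \<le> a j}"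
        proof (cases "J = {}")
          case False
          then show ?thesis
            using eq J a by (simp add: P1.emeasure_eq_measure P2.emeasure_eq_measure
                extremal_integrals_cdf[OF W1 J(1) False J(2)] extremal_integrals_cdf[OF W2 J(1) False J(2)])
        qed (simp add: P1.emeasure_space_1 P2.emeasure_space_1)
      qed (use J extremal_integrals_nonneg[OF W1] extremal_integrals_nonneg[OF W2] in
          \<open>auto intro: P1.finite_measure_axioms P2.finite_measure_axioms\<close>)
    qed
  qed
qed

text \<open>
  Restricting to \<open>A1\<close> and \<open>A2\<close> keeps the families nonnegative and \<open>\<alpha>\<close>-integrable, so the equivalence
  of exponents applies to the restricted families themselves.
\<close>

theorem theorem5p1:
  fixes \<alpha> :: real and T :: "'t set"
    and M1 :: "'a measure" and M2 :: "'b measure"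
    and f1 :: "'t \<Rightarrow> 'a \<Rightarrow> real" and f2 :: "'t \<Rightarrow> 'b \<Rightarrow> real"
    and A1 :: "'a set" and A2 :: "'b set"
    and PX :: "'x measure" and X :: "'t \<Rightarrow> 'x \<Rightarrow> real"
    and PY :: "'y measure" and Y :: "'t \<Rightarrow> 'y \<Rightarrow> real"
    and PW1 :: "'w1 measure" and W1 :: "'t \<Rightarrow> 'w1 \<Rightarrow> real"
    and PW2 :: "'w2 measure" and W2 :: "'t \<Rightarrow> 'w2 \<Rightarrow> real"
    and PZ1 :: "'z1 measure" and Z1 :: "'t \<Rightarrow> 'z1 \<Rightarrow> real"
    and PZ2 :: "'z2 measure" and Z2 :: "'t \<Rightarrow> 'z2 \<Rightarrow> real"
    and PU1 :: "'u1 measure" and U1 :: "'t \<Rightarrow> 'u1 \<Rightarrow> real"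
    and PU2 :: "'u2 measure" and U2 :: "'t \<Rightarrow> 'u2 \<Rightarrow> real"
    and PV1 :: "'v1 measure" and V1 :: "'t \<Rightarrow> 'v1 \<Rightarrow> real"
    and PV2 :: "'v2 measure" and V2 :: "'t \<Rightarrow> 'v2 \<Rightarrow> real"
  assumes alpha: "0 < \<alpha>" "\<alpha> < 2"
    and sigma_finite: "sigma_finite_measure M1" "sigma_finite_measure M2"
    and f1: "\<And>t. t \<in> T \<Longrightarrow> f1 t \<in> L_space_nonneg \<alpha> M1"
    and f2: "\<And>t. t \<in> T \<Longrightarrow> f2 t \<in> L_space_nonneg \<alpha> M2"
    and X: "frechet_process \<alpha> PX T X"
    and Y: "sas_process \<alpha> PY T Y"
    and W: "extremal_integrals \<alpha> M1 T f1 PW1 W1" "extremal_integrals \<alpha> M2 T f2 PW2 W2"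
    and Z: "stable_integrals \<alpha> M1 T f1 PZ1 Z1" "stable_integrals \<alpha> M2 T f2 PZ2 Z2"
    and X_rep: "eq_fdd T PX X PW1 W1" "eq_fdd T PX X PW2 W2"
    and Y_rep: "eq_fdd T PY Y PZ1 Z1" "eq_fdd T PY Y PZ2 Z2"
    and A: "A1 \<in> sets M1" "A2 \<in> sets M2"
    and U: "extremal_integrals \<alpha> M1 T (restrict_family A1 f1) PU1 U1"
           "extremal_integrals \<alpha> M2 T (restrict_family A2 f2) PU2 U2"
    and V: "stable_integrals \<alpha> M1 T (restrict_family A1 f1) PV1 V1"
           "stable_integrals \<alpha> M2 T (restrict_family A2 f2) PV2 V2"
  shows "eq_fdd T PU1 U1 PU2 U2 \<longleftrightarrow> eq_fdd T PV1 V1 PV2 V2"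
proof -
  have g1: "restrict_family A1 f1 t \<in> L_space_nonneg \<alpha> M1" if "t \<in> T" for t
    by (rule restrict_family_in_L_space_nonneg[of _ f1, OF alpha(1) f1[OF that] A(1)])
  have g2: "restrict_family A2 f2 t \<in> L_space_nonneg \<alpha> M2" if "t \<in> T" for t
    by (rule restrict_family_in_L_space_nonneg[of _ f2, OF alpha(1) f2[OF that] A(2)])
  have iff: "(\<forall>b. (LINT x|M1. \<bar>\<Sum>j\<in>J. b j * restrict_family A1 f1 j x\<bar> powr \<alpha>) =
          (LINT x|M2. \<bar>\<Sum>j\<in>J. b j * restrict_family A2 f2 j x\<bar> powr \<alpha>)) \<longleftrightarrow>
      (\<forall>a. (\<forall>j\<in>J. 0 < a j) \<longrightarrow>
        (LINT x|M1. (MAX j\<in>J. restrict_family A1 f1 j x / a j) powr \<alpha>) =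
        (LINT x|M2. (MAX j\<in>J. restrict_family A2 f2 j x / a j) powr \<alpha>))"
    if "finite J \<and> J \<noteq> {} \<and> J \<subseteq> T" for J
    using that by (intro stable_exponents_eq_iff_frechet_exponents_eq alpha g1 g2) auto
  show ?thesis
    unfolding extremal_integrals_eq_fdd_iff[OF U] stable_integrals_eq_fdd_iff[OF V]
    by (rule all_cong1, rule imp_cong[OF refl], rule iff[symmetric])
qed

end
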